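(* Let $(\overline{K}(X)|K,v)$ be an extension of valued fields. Assume that $(K(X)|K,v)$ is valuation algebraic. Let $\widehat{K}$ be the completion of $(K,v)$ and fix an extension of $v$ to $\overline{\widehat{K}}$. Take a cofinal well-ordered subset $\{\gamma_\nu\}_{\nu<\lambda}\subseteq v(X-\overline{K})$ and $\{a_\nu\}_{\nu<\lambda}\subseteq\overline{K}$ such that $v(X-a_\nu)=\gamma_\nu$ for all $\nu<\lambda$. Take a complete sequence of key polynomials $\{Q_\mu\}_{\mu\in\Lambda}$ for $v$ over $K$. Then one of the following cases holds: (Case I) $\{a_\nu\}_{\nu<\lambda}$ is a pseudo-Cauchy sequence of transcendental type in $(\overline{\widehat{K}},v)$. Then $\{Q_\mu\}_{\mu\in\Lambda}$ forms a complete sequence of key polynomials for the induced extension $(\widehat{K}(X)|\widehat{K},v)$. Further, $(\widehat{K}(X)|K(X),v)$ is an immediate extension. (Case II) $\{a_\nu\}_{\nu<\lambda}$ is a pseudo-Cauchy sequence of algebraic type in $(\overline{\widehat{K}},v)$. Then $\{a_\nu\}_{\nu<\lambda}$ is a Cauchy sequence in $(\overline{K},v)$. Take the unique limit $a\in\overline{\widehat{K}}$ of $\{a_\nu\}_{\nu<\lambda}$. Then $\{Q_\mu\}_{\mu\in\Lambda'}\cup\{\widehat{Q}_a\}$ forms a complete sequence of key polynomials for the induced extension $(\widehat{K}(X)|\widehat{K},v)$, where $\widehat{Q}_a$ is the minimal polynomial of $a$ over $\widehat{K}$ and $\Lambda':=\{\mu\in\Lambda\mid\deg Q_\mu\le\deg\widehat{Q}_a\}$.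 Further, the element $a$ is uniquely determined, that is, it is independent of the choice of the sequences $\{\gamma_\nu\}_{\nu<\lambda}$ and $\{a_\nu\}_{\nu<\lambda}$.
   Context: Valuations are Krull valuations written additively; $vL$, $Lv$ denote value group and residue field. An extension is immediate if value groups and residue fields coincide. $(K,v)$ is dense in $(L,v)$ if for every $a\in L$, $\gamma\in vL$ there is $b\in K$ with $v(a-b)>\gamma$; the completion $(\widehat{K},v)$ is the maximal extension in which $(K,v)$ is dense. $\overline{K}\subseteq\overline{\widehat{K}}$ are algebraic closures; the extension of $v$ to $\overline{\widehat{K}}$ is understood to extend both the valuation of $\widehat{K}$ and the given one on $\overline{K}$. Write $v(X-\overline{K}):=\{v(X-c)\mid c\in\overline{K}\}$; the sequence $\{\gamma_\nu\}_{\nu<\lambda}$ is strictly increasing and $\lambda$ is a limit ordinal. $(K(X)|K,v)$ is valuation algebraic if $vK(X)/vK$ is a torsion group and $K(X)v|Kv$ is algebraic. A sequence $\{z_\nu\}_{\nu<\lambda}$ in a valued field is a pseudo-Cauchy sequence (pCs) if $v(z_{\nu_1}-z_{\nu_2})<v(z_{\nu_2}-z_{\nu_3})$ for all $\nu_1<\nu_2<\nu_3<\lambda$. An element $y$ of an extension is a limit if $v(y-z_\nu)=v(z_\nu-z_{\nu+1})$ for all $\nu$. A pCs in $(F,v)$ is a Cauchy sequence if the values $v(z_\nu-z_{\nu+1})$ are cofinal in $vF$. It is of transcendental type in $(F,v)$ if $\{vh(z_\nu)\}$ is ultimately constant for every polynomial $h$ over $F$, and of algebraic type otherwise. The sequence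 $\{a_\nu\}$ in the claim is a pCs with limit $X$. For $a\in\overline{F}$ and $\gamma$ in an ordered abelian group containing $v\overline{F}$, $v_{a,\gamma}$ is the valuation on $\overline{F}(X)$ with $v_{a,\gamma}\big(\sum C_i(X-a)^i\big)=\min_i\{vC_i+i\gamma\}$. The induced extension $(\widehat{K}(X)|\widehat{K},v)$ is the restriction to $\widehat{K}(X)$ of the following extension of $v$ from $\overline{\widehat{K}}$ and $\overline{K}(X)$ to $\overline{\widehat{K}}(X)$: in Case I, the unique extension of $v$ from $\overline{\widehat{K}}$ to $\overline{\widehat{K}}(X)$ such that $X$ is a limit of $\{a_\nu\}$; in Case II, $v_{a,\gamma}$ with $a\in\overline{\widehat{K}}$ the limit of $\{a_\nu\}$ and $\gamma=(1,0)\in(\mathbb{Z}\oplus v\overline{K})_{\mathrm{lex}}$, $v\overline{K}$ being embedded by $\alpha\mapsto(0,\alpha)$. Key polynomials (for a valuation $v$ on $\overline{F}(X)$, over a base field $F$; for the induced extension use $F=\widehat{K}$ and the valuation on $\overline{\widehat{K}}(X)$ whose restriction to $\widehat{K}(X)$ is the induced extension, namely: in Case I, the unique extension of $v$ from $\overline{\widehat{K}}$ to $\overline{\widehat{K}}(X)$ such that $X$ is a limit of $\{a_\nu\}$; in Case II, the valuation $v_{a,\gamma}$ with $a\in\overline{\widehat{K}}$ the limit of $\{a_\nu\}$ and $\gamma=(1,0)\in(\mathbb{Z}\oplus v\overline{K})_{\mathrm{lex}}$): for nonconstant $f\in F[X]$ put $\delta(f):=\max\{v(X-a)\mid a\in\overline{F}\text{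 a root of }f\}$. A nonconstant monic $Q\in F[X]$ is a key polynomial for $v$ over $F$ if $\delta(f)<\delta(Q)$ for every nonconstant $f\in F[X]$ with $\deg f<\deg Q$. For such $Q$ and $f=\sum f_iQ^i$ with $\deg f_i<\deg Q$, put $v_Q(f):=\min_i\{vf_i+i\,vQ\}$. A family $\Lambda$ of key polynomials for $v$ over $F$ is a complete sequence of key polynomials for $v$ over $F$ if: (1) $\delta(Q)\ne\delta(Q')$ for distinct $Q,Q'\in\Lambda$; (2) $\Lambda$ is well ordered by $Q<Q'\iff\delta(Q)<\delta(Q')$; (3) for every nonconstant $f\in F[X]$ there is $Q\in\Lambda$ with $\deg Q\le\deg f$ and $vf=v_Qf$. *)

theory Defs
  imports
    "HOL-Algebra.Algebraic_Closure_Type"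
    "HOL-Library.Extended"
    "HOL-Library.Product_Plus"
    "HOL-Library.Product_Lexorder"
begin

section \<open>Valued fields\<close>

text \<open>
  A valuation takes values in \<^typ>\<open>'g extended\<close>, where \<^typ>\<open>'g\<close> is any linearly ordered abelian
  group containing the value group, \<open>v x = \<infinity>\<close> exactly for \<open>x = 0\<close>, and the value \<open>-\<infinity>\<close> of the
  library type is never taken.
\<close>

definition valued_field ::
    "('l, 'm) ring_scheme \<Rightarrow> ('l \<Rightarrow> 'g::linordered_ab_group_add extended) \<Rightarrow> bool" where
  "valued_field R v \<longleftrightarrow> field R \<and>
     (\<forall>x\<in>carrier R. v x \<noteq> -\<infinity> \<and> (v x = \<infinity> \<longleftrightarrow> x = \<zero>\<^bsub>R\<^esub>)) \<and>
     (\<forall>x\<in>carrier R. \<forall>y\<in>carrier R. v (x \<otimes>\<^bsub>R\<^esub> y) = v x + v y) \<and>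
     (\<forall>x\<in>carrier R. \<forall>y\<in>carrier R. min (v x) (v y) \<le> v (x \<oplus>\<^bsub>R\<^esub> y))"

definition value_group :: "('l, 'm) ring_scheme \<Rightarrow> ('l \<Rightarrow> 'g extended) \<Rightarrow> 'g extended set" where
  "value_group R v = v ` (carrier R - {\<zero>\<^bsub>R\<^esub>})"

definition valuation_ring ::
    "'l ring \<Rightarrow> ('l \<Rightarrow> 'g::linordered_ab_group_add extended) \<Rightarrow> 'l ring" where
  "valuation_ring R v = R\<lparr>carrier := {x \<in> carrier R. 0 \<le> v x}\<rparr>"

definition valuation_ideal ::
    "'l ring \<Rightarrow> ('l \<Rightarrow> 'g::linordered_ab_group_add extended) \<Rightarrow> 'l set" where
  "valuation_ideal R v = {x \<in> carrier R. 0 < v x}"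

definition residue_field ::
    "'l ring \<Rightarrow> ('l \<Rightarrow> 'g::linordered_ab_group_add extended) \<Rightarrow> 'l set ring" where
  "residue_field R v = valuation_ring R v Quot valuation_ideal R v"

text \<open>The residue field \<open>Fv\<close> of a subfield \<open>F\<close> of \<open>R\<close>, as a subfield of the residue field \<open>Rv\<close>.\<close>

definition residues ::
    "'l ring \<Rightarrow> ('l \<Rightarrow> 'g::linordered_ab_group_add extended) \<Rightarrow> 'l set \<Rightarrow> 'l set set" where
  "residues R v F =
     (\<lambda>x. valuation_ideal R v +>\<^bsub>valuation_ring R v\<^esub> x) ` {x \<in> F. 0 \<le> v x}"

definition dense_in ::
    "'l set \<Rightarrow> ('l, 'm) ring_scheme \<Rightarrow> ('l \<Rightarrow> 'g::linordered_ab_group_add extended) \<Rightarrow> bool" where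
  "dense_in F R v \<longleftrightarrow>
     (\<forall>a\<in>carrier R. \<forall>\<gamma>\<in>value_group R v. \<exists>b\<in>F. \<gamma> < v (a \<ominus>\<^bsub>R\<^esub> b))"

definition nat_mult :: "nat \<Rightarrow> 'h::comm_monoid_add \<Rightarrow> 'h" where
  "nat_mult n \<gamma> = (\<Sum>j<n. \<gamma>)"

subsection \<open>Subfields of a type-class field\<close>

abbreviation whole_field :: "'l::field ring" where
  "whole_field \<equiv> ring_of_type_algebra"

abbreviation field_on :: "'l::field set \<Rightarrow> 'l ring" where
  "field_on F \<equiv> ring_of_type_algebra\<lparr>carrier := F\<rparr>"

definition valued_extension ::
    "'l::field set \<Rightarrow> ('l \<Rightarrow> 'g::linordered_ab_group_add extended) \<Rightarrow>
     'l set \<Rightarrow> ('l \<Rightarrow> 'g extended) \<Rightarrow> bool" where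
  "valued_extension F v L u \<longleftrightarrow>
     valued_field (field_on F) v \<and> valued_field (field_on L) u \<and> F \<subseteq> L \<and> (\<forall>x\<in>F. u x = v x)"

definition immediate_extension ::
    "'l::field set \<Rightarrow> ('l \<Rightarrow> 'g::linordered_ab_group_add extended) \<Rightarrow>
     'l set \<Rightarrow> ('l \<Rightarrow> 'g extended) \<Rightarrow> bool" where
  "immediate_extension F v L u \<longleftrightarrow> valued_extension F v L u \<and>
     value_group (field_on L) u = value_group (field_on F) v \<and>
     carrier (residue_field (field_on L) u) = residues (field_on L) u F"

definition valuation_algebraic ::
    "'l::field set \<Rightarrow> 'l set \<Rightarrow> ('l \<Rightarrow> 'g::linordered_ab_group_add extended) \<Rightarrow> bool" where
  "valuation_algebraic F L v \<longleftrightarrow>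
     (\<forall>\<gamma>\<in>value_group (field_on L) v. \<exists>n>0. nat_mult n \<gamma> \<in> value_group (field_on F) v) \<and>
     (\<forall>\<xi>\<in>carrier (residue_field (field_on L) v).
        (ring.algebraic (residue_field (field_on L) v) over residues (field_on L) v F) \<xi>)"

text \<open>
  The completion is the maximal extension in which \<open>K\<close> is dense.  The competing extensions
  \<open>(M, u)\<close> of \<open>(Khat, w)\<close> range over all fields with carrier in \<^typ>\<open>'g \<Rightarrow> 'a\<close>, which up to
  isomorphism is no restriction: if \<open>K\<close> is dense in \<open>(M, u)\<close>, then \<open>M\<close> has the same value group
  as \<open>K\<close>, and sending \<open>m\<close> to a function that picks for each \<open>\<gamma>\<close> in this group some
  \<open>b \<in> K\<close> with \<open>u (m - b) > \<gamma>\<close> is injective.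
\<close>

definition is_completion ::
    "'a::field set \<Rightarrow> 'a set \<Rightarrow> ('a \<Rightarrow> 'g::linordered_ab_group_add extended) \<Rightarrow> bool" where
  "is_completion K Khat w \<longleftrightarrow>
     valued_extension K w Khat w \<and> dense_in K (field_on Khat) w \<and>
     (\<forall>(M :: ('g \<Rightarrow> 'a) ring) u \<iota>.
        valued_field M u \<and> \<iota> \<in> ring_hom (field_on Khat) M \<and> (\<forall>x\<in>Khat. u (\<iota> x) = w x) \<and>
        dense_in (\<iota> ` K) M u \<longrightarrow> \<iota> ` Khat = carrier M)"

section \<open>Polynomials and rational functions over a subfield\<close>

definition polys_over :: "'a::field set \<Rightarrow> 'a poly set" where
  "polys_over F = {p. \<forall>i. Polynomial.coeff p i \<in> F}"

definition ratfuncs_over :: "'a::field set \<Rightarrow> 'a poly fract set" where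
  "ratfuncs_over F = {to_fract p / to_fract q |p q. p \<in> polys_over F \<and> q \<in> polys_over F \<and> q \<noteq> 0}"

abbreviation const_fract :: "'a::field \<Rightarrow> 'a poly fract" where
  "const_fract c \<equiv> to_fract [:c:]"

abbreviation X_fract :: "'a::field poly fract" where
  "X_fract \<equiv> to_fract [:0, 1:]"

text \<open>The algebraic closure of \<open>F\<close> inside the (algebraically closed) ambient field.\<close>

definition algebraic_closure_of :: "'a::alg_closed_field set \<Rightarrow> 'a set" where
  "algebraic_closure_of F = {x. \<exists>p\<in>polys_over F. p \<noteq> 0 \<and> poly p x = 0}"

definition minimal_poly :: "'a::field set \<Rightarrow> 'a \<Rightarrow> 'a poly" where
  "minimal_poly F a = (THE Q. Q \<in> polys_over F \<and> Polynomial.lead_coeff Q = 1 \<and> poly Q a = 0 \<and>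
     (\<forall>f\<in>polys_over F. f \<noteq> 0 \<and> poly f a = 0 \<longrightarrow> Polynomial.degree Q \<le> Polynomial.degree f))"

section \<open>Pseudo-Cauchy sequences\<close>

text \<open>
  A sequence indexed by the ordinals below a limit ordinal is a function on a well-ordered type
  without greatest element; \<open>succ_index \<nu>\<close> is \<open>\<nu> + 1\<close>.
\<close>

definition succ_index :: "'i::{wellorder,no_top} \<Rightarrow> 'i" where
  "succ_index \<nu> = (LEAST \<mu>. \<nu> < \<mu>)"

definition pseudo_cauchy ::
    "('l::field \<Rightarrow> 'g::linordered_ab_group_add extended) \<Rightarrow> ('i::{wellorder,no_top} \<Rightarrow> 'l) \<Rightarrow> bool" where
  "pseudo_cauchy v z \<longleftrightarrow>
     (\<forall>\<nu>1 \<nu>2 \<nu>3. \<nu>1 < \<nu>2 \<and> \<nu>2 < \<nu>3 \<longrightarrow> v (z \<nu>1 - z \<nu>2) < v (z \<nu>2 - z \<nu>3))"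

definition pcs_limit ::
    "('l::field \<Rightarrow> 'g::linordered_ab_group_add extended) \<Rightarrow> ('i::{wellorder,no_top} \<Rightarrow> 'l) \<Rightarrow> 'l \<Rightarrow> bool" where
  "pcs_limit v z y \<longleftrightarrow> (\<forall>\<nu>. v (y - z \<nu>) = v (z \<nu> - z (succ_index \<nu>)))"

definition cauchy_sequence ::
    "'l::field set \<Rightarrow> ('l \<Rightarrow> 'g::linordered_ab_group_add extended) \<Rightarrow>
     ('i::{wellorder,no_top} \<Rightarrow> 'l) \<Rightarrow> bool" where
  "cauchy_sequence F v z \<longleftrightarrow> range z \<subseteq> F \<and> pseudo_cauchy v z \<and>
     (\<forall>\<gamma>\<in>value_group (field_on F) v. \<exists>\<nu>. \<gamma> \<le> v (z \<nu> - z (succ_index \<nu>)))"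

definition pcs_transcendental ::
    "'l::field set \<Rightarrow> ('l \<Rightarrow> 'g::linordered_ab_group_add extended) \<Rightarrow>
     ('i::{wellorder,no_top} \<Rightarrow> 'l) \<Rightarrow> bool" where
  "pcs_transcendental F v z \<longleftrightarrow> range z \<subseteq> F \<and> pseudo_cauchy v z \<and>
     (\<forall>h\<in>polys_over F. \<exists>c \<nu>0. \<forall>\<nu>\<ge>\<nu>0. v (poly h (z \<nu>)) = c)"

definition pcs_algebraic ::
    "'l::field set \<Rightarrow> ('l \<Rightarrow> 'g::linordered_ab_group_add extended) \<Rightarrow>
     ('i::{wellorder,no_top} \<Rightarrow> 'l) \<Rightarrow> bool" where
  "pcs_algebraic F v z \<longleftrightarrow> range z \<subseteq> F \<and> pseudo_cauchy v z \<and> \<not> pcs_transcendental F v z"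

text \<open>
  The values \<open>\<gamma>\<^sub>\<nu> = v (X - a\<^sub>\<nu>)\<close> enumerate a cofinal well-ordered subset of
  \<open>{v (X - c) | c \<in> Kbar}\<close>.
\<close>

definition cofinal_approximation ::
    "'a::field set \<Rightarrow> ('a poly fract \<Rightarrow> 'g::linordered_ab_group_add extended) \<Rightarrow>
     ('i::{wellorder,no_top} \<Rightarrow> 'g extended) \<Rightarrow> ('i \<Rightarrow> 'a) \<Rightarrow> bool" where
  "cofinal_approximation Kbar v \<gamma> a \<longleftrightarrow>
     strict_mono \<gamma> \<and> range \<gamma> \<subseteq> {v (X_fract - const_fract c) |c. c \<in> Kbar} \<and>
     (\<forall>c\<in>Kbar. \<exists>\<nu>. v (X_fract - const_fract c) \<le> \<gamma> \<nu>) \<and>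
     (\<forall>\<nu>. a \<nu> \<in> Kbar \<and> v (X_fract - const_fract (a \<nu>)) = \<gamma> \<nu>)"

section \<open>Extensions of a valuation to the rational function field\<close>

text \<open>
  The extension of \<open>w\<close> for which \<open>X\<close> is a limit of \<open>a\<close>; it exists and is unique if \<open>a\<close> is of
  transcendental type in an algebraically closed field, its values then being those of \<open>w\<close>.
\<close>

definition limit_extension ::
    "('a::field \<Rightarrow> 'g::linordered_ab_group_add extended) \<Rightarrow> ('i::{wellorder,no_top} \<Rightarrow> 'a) \<Rightarrow>
     'a poly fract \<Rightarrow> 'g extended" where
  "limit_extension w a = (THE u. valued_field whole_field u \<and> (\<forall>c. u (const_fract c) = w c) \<and>
     pcs_limit u (\<lambda>\<nu>. const_fract (a \<nu>)) X_fract)"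

text \<open>The coefficients of \<open>p(X + a)\<close> are the coefficients \<open>C\<^sub>i\<close> in \<open>p = \<Sum> C\<^sub>i (X - a)\<^sup>i\<close>.\<close>

definition monomial_valuation ::
    "('a::field \<Rightarrow> 'h::linordered_ab_group_add extended) \<Rightarrow> 'a \<Rightarrow> 'h \<Rightarrow> 'a poly fract \<Rightarrow> 'h extended" where
  "monomial_valuation w a \<gamma> = (THE u. valued_field whole_field u \<and>
     (\<forall>p. u (to_fract p) =
        Min ((\<lambda>i. w (Polynomial.coeff (pcompose p [:a, 1:]) i) + nat_mult i (Fin \<gamma>))
               ` {..Polynomial.degree p})))"

text \<open>The product \<open>\<int> \<oplus> \<Gamma>\<close> with lexicographic order, the first component being dominant.\<close>

instance prod :: (linordered_ab_group_add, linordered_ab_group_add) linordered_ab_group_add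
proof
  fix a b c :: "'a \<times> 'b"
  assume "a \<le> b"
  then show "c + a \<le> c + b"
    by (cases a; cases b; cases c) auto
qed

definition lex_lift :: "('a \<Rightarrow> 'g extended) \<Rightarrow> 'a \<Rightarrow> (int \<times> 'g) extended" where
  "lex_lift w x = map_extended (\<lambda>\<alpha>. (0, \<alpha>)) (w x)"

section \<open>Key polynomials\<close>

text \<open>
  The roots in the ambient algebraically closed field all lie in the algebraic closure of the field
  of coefficients, so for \<open>f\<close> over \<open>K\<close> only values of \<open>v\<close> on \<open>Kbar(X)\<close> enter.
\<close>

definition delta ::
    "('a::field poly fract \<Rightarrow> 'g::linordered_ab_group_add extended) \<Rightarrow> 'a poly \<Rightarrow> 'g extended" where
  "delta v f = Max ((\<lambda>a. v (X_fract - const_fract a)) ` {a. poly f a = 0})"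

definition key_poly ::
    "'a::field set \<Rightarrow> ('a poly fract \<Rightarrow> 'g::linordered_ab_group_add extended) \<Rightarrow> 'a poly \<Rightarrow> bool" where
  "key_poly F v Q \<longleftrightarrow>
     Q \<in> polys_over F \<and> Polynomial.degree Q > 0 \<and> Polynomial.lead_coeff Q = 1 \<and>
     (\<forall>f\<in>polys_over F. Polynomial.degree f > 0 \<and> Polynomial.degree f < Polynomial.degree Q
        \<longrightarrow> delta v f < delta v Q)"

text \<open>
  \<open>(f div Q\<^sup>i) mod Q\<close> is the coefficient \<open>f\<^sub>i\<close> of the \<open>Q\<close>-adic expansion \<open>f = \<Sum> f\<^sub>i Q\<^sup>i\<close>, and it
  vanishes for \<open>i > degree f\<close> when \<open>Q\<close> is nonconstant.
\<close>

definition truncation ::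
    "('a::field poly fract \<Rightarrow> 'g::linordered_ab_group_add extended) \<Rightarrow> 'a poly \<Rightarrow> 'a poly \<Rightarrow>
     'g extended" where
  "truncation v Q f =
     Min ((\<lambda>i. v (to_fract ((f div Q ^ i) mod Q)) + nat_mult i (v (to_fract Q)))
            ` {..Polynomial.degree f})"

definition complete_key_sequence ::
    "'a::field set \<Rightarrow> ('a poly fract \<Rightarrow> 'g::linordered_ab_group_add extended) \<Rightarrow> 'a poly set \<Rightarrow> bool" where
  "complete_key_sequence F v \<Lambda> \<longleftrightarrow>
     (\<forall>Q\<in>\<Lambda>. key_poly F v Q) \<and>
     (\<forall>Q\<in>\<Lambda>. \<forall>Q'\<in>\<Lambda>. Q \<noteq> Q' \<longrightarrow> delta v Q \<noteq> delta v Q') \<and>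
     well_order_on \<Lambda> {(Q, Q'). Q \<in> \<Lambda> \<and> Q' \<in> \<Lambda> \<and> (Q = Q' \<or> delta v Q < delta v Q')} \<and>
     (\<forall>f\<in>polys_over F. Polynomial.degree f > 0 \<longrightarrow>
        (\<exists>Q\<in>\<Lambda>. Polynomial.degree Q \<le> Polynomial.degree f \<and> v (to_fract f) = truncation v Q f))"

end

theory Submission
  imports Defs
begin

text \<open>
  For a key polynomial \<open>Q\<close> the equation \<open>v f = v\<^sub>Q f\<close> means \<open>\<delta>(f) \<le> \<delta>(Q)\<close>, since \<open>v\<^sub>Q\<close> is the
  restriction of the Gauss valuation centred at a root \<open>b\<close> of \<open>Q\<close> with \<open>v(X - b) = \<delta>(Q)\<close>.  Hence key
  polynomials and completeness depend only on the values \<open>\<delta>(f)\<close>.  If \<open>\<delta>(f)\<close> is bounded by a value of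
  the ground field for some \<open>f\<close> over \<open>Khat\<close>, continuity of roots gives a polynomial of the same degree
  over \<open>K\<close> with at least the same \<open>\<delta>\<close>, so nothing changes on passing from \<open>K\<close> to \<open>Khat\<close>.

  The two cases are distinguished by the existence of \<open>\<alpha>\<close> with \<open>w (\<alpha> - a\<^sub>\<nu>) = \<gamma>\<^sub>\<nu>\<close> for all \<open>\<nu>\<close>.  Without
  such \<open>\<alpha>\<close> every linear, hence every polynomial value along the sequence is ultimately constant.  With
  it, density of \<open>Kbar\<close> forces the \<open>\<gamma>\<^sub>\<nu>\<close> to be cofinal, so that \<open>\<alpha>\<close> is the only limit and
  \<open>v (X - c) = w (\<alpha> - c)\<close> on \<open>Kbar\<close>; only polynomials vanishing at \<open>\<alpha>\<close> have \<open>\<delta>\<close> beyond the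
  values of the ground field, and these are governed by the minimal polynomial of \<open>\<alpha>\<close>.
\<close>

text \<open>Over an algebraically closed field, a valuation of the rational functions is fixed by
  its values on constants and on the polynomials \<open>X - c\<close>, so constructions and
  comparisons are carried out on linear factors. The given \<open>v\<close>, however, is controlled
  only over \<open>Kbar\<close>, whereas roots of polynomials over \<open>Khat\<close> may lie
  anywhere in the ambient field; polynomials over \<open>K\<close> split over \<open>Kbar\<close>,
  and these are the ones compared with \<open>v\<close> directly. The two induced extensions have
  different value groups. One transfer along a strictly increasing homomorphism of values serves
  both, with the identity in Case I and \<open>lex_embed\<close> in Case II. There
  \<open>(1, 0)\<close> exceeds the image of every finite value of \<open>w\<close>, which puts
  \<open>X\<close> closer to \<open>\<alpha>\<close> than any other constant is. A further gap is
  that density of \<open>K\<close> is measured by values of \<open>Khat\<close> alone. It reaches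
  arbitrary finite values because the values of \<open>Khat\<close> are cofinal among those of its
  algebraic closure.\<close>

section \<open>Arithmetic of extended values\<close>

lemma ext_add_less_mono:
  fixes a b c :: "'g::linordered_ab_group_add extended"
  assumes "a < b" "c \<noteq> \<infinity>" "c \<noteq> -\<infinity>"
  shows "c + a < c + b"
  using assms by (cases a; cases b; cases c) auto

lemma ext_add_le_cancel:
  fixes a b c :: "'g::linordered_ab_group_add extended"
  assumes "c \<noteq> \<infinity>" "c \<noteq> -\<infinity>"
  shows "c + a \<le> c + b \<longleftrightarrow> a \<le> b"
  using assms by (cases a; cases b; cases c) auto

lemma ext_add_cancel:
  fixes a b c :: "'g::linordered_ab_group_add extended"
  assumes "c \<noteq> \<infinity>" "c \<noteq> -\<infinity>"
  shows "c + a = c + b \<longleftrightarrow> a = b"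
  using assms by (cases a; cases b; cases c) auto

lemma ext_add_less_le_mono:
  fixes a b c d :: "'g::linordered_ab_group_add extended"
  assumes "a < b" "c \<le> d" "c \<noteq> \<infinity>" "c \<noteq> -\<infinity>"
  shows "a + c < b + d"
  using assms by (cases a; cases b; cases c; cases d) (auto intro: add_less_le_mono)

lemma ext_add_eq_Pinf_iff:
  fixes a b :: "'g::linordered_ab_group_add extended"
  shows "a + b = \<infinity> \<longleftrightarrow> a = \<infinity> \<or> b = \<infinity>"
  by (cases a; cases b) auto

lemma ext_add_Pinf [simp]:
  fixes x :: "'g::linordered_ab_group_add extended"
  shows "\<infinity> + x = \<infinity>" "x + \<infinity> = \<infinity>"
  by (cases x; simp)+

lemma ext_add_Fin_0 [simp]:
  fixes x :: "'g::linordered_ab_group_add extended"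
  shows "Fin 0 + x = x" "x + Fin 0 = x"
  by (cases x; simp)+

lemma ext_add_neq_Minf:
  fixes a b :: "'g::linordered_ab_group_add extended"
  assumes "a \<noteq> -\<infinity>" "b \<noteq> -\<infinity>"
  shows "a + b \<noteq> -\<infinity>"
  using assms by (cases a; cases b) auto

lemma nat_mult_0 [simp]: "nat_mult 0 x = 0"
  by (simp add: nat_mult_def)

lemma nat_mult_Suc: "nat_mult (Suc n) x = x + nat_mult n x"
  by (simp add: nat_mult_def add.commute)

lemma nat_mult_add: "nat_mult (m + n) x = nat_mult m x + nat_mult n x"
  by (induction m) (simp_all add: nat_mult_Suc add.assoc)

lemma nat_mult_Fin: "nat_mult n (Fin x) = Fin (nat_mult n x)"
  by (induction n) (simp_all add: nat_mult_Suc zero_extended_def)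

lemma nat_mult_Fin_neq [simp]: "nat_mult n (Fin x) \<noteq> \<infinity>" "nat_mult n (Fin x) \<noteq> -\<infinity>"
  by (simp_all add: nat_mult_Fin)

section \<open>Subfields and valuations\<close>

text \<open>Four closure conditions in type-class operations stand in for the record-based notion of
  a subfield, so that membership goals are settled by simplification. Since
  \<open>inverse 0 = 0\<close>, the last condition is harmless at zero.\<close>

locale subfield_set =
  fixes F :: "'l::field set"
  assumes one_mem [simp]: "1 \<in> F"
    and diff_mem [simp]: "x \<in> F \<Longrightarrow> y \<in> F \<Longrightarrow> x - y \<in> F"
    and mult_mem [simp]: "x \<in> F \<Longrightarrow> y \<in> F \<Longrightarrow> x * y \<in> F"
    and inverse_mem [simp]: "x \<in> F \<Longrightarrow> inverse x \<in> F"
begin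

lemma zero_mem [simp]: "0 \<in> F"
  using diff_mem[of 1 1] by simp

lemma uminus_mem [simp]: "x \<in> F \<Longrightarrow> - x \<in> F"
  using diff_mem[of 0 x] by simp

lemma add_mem [simp]: "x \<in> F \<Longrightarrow> y \<in> F \<Longrightarrow> x + y \<in> F"
  using diff_mem[of x "- y"] by simp

lemma divide_mem [simp]: "x \<in> F \<Longrightarrow> y \<in> F \<Longrightarrow> x / y \<in> F"
  by (simp add: divide_inverse)

lemma sum_mem [simp]: "(\<And>i. i \<in> A \<Longrightarrow> f i \<in> F) \<Longrightarrow> sum f A \<in> F"
  by (induction A rule: infinite_finite_induct) simp_all

lemma field_field_on: "field (field_on F)"
proof -
  have "\<exists>y\<in>F. x + y = 0" if "x \<in> F" for x
    using that by (intro bexI[of _ "- x"]) simp_all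
  moreover have "\<exists>y\<in>F. y * x = 1" if "x \<in> F" "x \<noteq> 0" for x
    using that by (intro bexI[of _ "inverse x"]) simp_all
  ultimately show ?thesis
    unfolding ring_of_type_algebra_def
    by unfold_locales (auto simp: algebra_simps Units_def)
qed

end

lemma field_on_simps [simp]:
  "carrier (field_on F) = F" "\<zero>\<^bsub>field_on F\<^esub> = 0" "\<one>\<^bsub>field_on F\<^esub> = 1"
  "x \<oplus>\<^bsub>field_on F\<^esub> y = x + y" "x \<otimes>\<^bsub>field_on F\<^esub> y = x * y"
  by (simp_all add: ring_of_type_algebra_def)

lemma whole_field_simps [simp]:
  "x \<oplus>\<^bsub>whole_field\<^esub> y = x + y" "x \<otimes>\<^bsub>whole_field\<^esub> y = x * y"
  by (simp_all add: ring_of_type_algebra_def)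

lemma field_on_UNIV: "field_on UNIV = whole_field"
  by (simp add: ring_of_type_algebra_def)

lemma a_inv_field_on:
  assumes "field (field_on F)" "x \<in> F"
  shows "\<ominus>\<^bsub>field_on F\<^esub> x = - x"
proof -
  interpret field "field_on F" by fact
  have "x + \<ominus>\<^bsub>field_on F\<^esub> x = 0"
    using r_neg[of x] assms(2) by simp
  then show ?thesis
    by (simp add: eq_neg_iff_add_eq_0 add.commute)
qed

lemma a_minus_field_on:
  assumes "field (field_on F)" "x \<in> F" "y \<in> F"
  shows "x \<ominus>\<^bsub>field_on F\<^esub> y = x - y"
  using a_inv_field_on[OF assms(1,3)] by (simp add: a_minus_def)

lemma subfield_set_field_on:
  assumes "field (field_on F)"
  shows "subfield_set F"
proof
  interpret field "field_on F" by fact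
  show "1 \<in> F"
    using one_closed by simp
  show "x * y \<in> F" if "x \<in> F" "y \<in> F" for x y
    using that m_closed[of x y] by simp
  show "x - y \<in> F" if "x \<in> F" "y \<in> F" for x y
    using that minus_closed[of x y] a_minus_field_on[OF assms, of x y] by simp
  show "inverse x \<in> F" if "x \<in> F" for x
  proof (cases "x = 0")
    case True
    then show ?thesis using zero_closed by simp
  next
    case False
    then have "x \<in> Units (field_on F)"
      using that by (simp add: field_Units)
    then obtain y where "y \<in> F" "y * x = 1"
      by (auto simp: Units_def)
    then show ?thesis
      using False by (metis inverse_unique mult.commute)
  qed
qed

text \<open>All conditions are relative to the carrier: the given \<open>v\<close> is a valuation on
  \<open>ratfuncs_over Kbar\<close> and may behave arbitrarily elsewhere.\<close>

locale valuation = subfield_set F for F :: "'l::field set" +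
  fixes v :: "'l \<Rightarrow> 'g::linordered_ab_group_add extended"
  assumes v_neq_Minf [simp]: "x \<in> F \<Longrightarrow> v x \<noteq> -\<infinity>"
    and v_eq_Pinf_iff [simp]: "x \<in> F \<Longrightarrow> v x = \<infinity> \<longleftrightarrow> x = 0"
    and v_mult: "x \<in> F \<Longrightarrow> y \<in> F \<Longrightarrow> v (x * y) = v x + v y"
    and v_add: "x \<in> F \<Longrightarrow> y \<in> F \<Longrightarrow> min (v x) (v y) \<le> v (x + y)"
begin

lemma v_0 [simp]: "v 0 = \<infinity>"
  by simp

lemma v_1 [simp]: "v 1 = 0"
proof -
  have "v 1 + v 1 = v 1 + 0"
    using v_mult[of 1 1] by simp
  then show ?thesis
    using ext_add_cancel[of "v 1" "v 1" 0] by simp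
qed

text \<open>From \<open>(-1) * (-1) = 1\<close> the value of \<open>-1\<close> is its own negative,
  and a linearly ordered group has no such element except zero.\<close>

lemma v_minus_1: "v (- 1) = 0"
proof -
  have *: "v (- 1) + v (- 1) = 0"
    using v_mult[of "-1" "-1"] by simp
  obtain g where g: "v (- 1) = Fin g"
    using v_neq_Minf[of "-1"] v_eq_Pinf_iff[of "-1"] by (cases "v (- 1)") auto
  then show ?thesis
    using * by (simp add: zero_extended_def double_zero)
qed

lemma v_uminus [simp]: "x \<in> F \<Longrightarrow> v (- x) = v x"
  using v_mult[of "-1" x] by (simp add: v_minus_1)

lemma v_diff_commute: "x \<in> F \<Longrightarrow> y \<in> F \<Longrightarrow> v (x - y) = v (y - x)"
  using v_uminus[of "x - y"] by simp

lemma v_diff: "x \<in> F \<Longrightarrow> y \<in> F \<Longrightarrow> min (v x) (v y) \<le> v (x - y)"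
  using v_add[of x "- y"] by simp

lemma v_add_eq:
  assumes "x \<in> F" "y \<in> F" "v x < v y"
  shows "v (x + y) = v x"
proof (rule antisym)
  have "min (v (x + y)) (v y) \<le> v x"
    using v_diff[of "x + y" y] assms by simp
  then show "v (x + y) \<le> v x"
    using assms(3) by (auto simp: min_def split: if_splits)
  show "v x \<le> v (x + y)"
    using v_add[of x y] assms by (simp add: min_def split: if_splits)
qed

lemma v_diff_eq:
  assumes "x \<in> F" "y \<in> F" "v x < v y"
  shows "v (x - y) = v x" "v (y - x) = v x"
  using v_add_eq[of x "- y"] v_diff_commute[of x y] assms by simp_all

lemma v_divide_add: "x \<in> F \<Longrightarrow> y \<in> F \<Longrightarrow> y \<noteq> 0 \<Longrightarrow> v y + v (x / y) = v x"
  using v_mult[of y "x / y"] by simp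

lemma v_finite: "x \<in> F \<Longrightarrow> x \<noteq> 0 \<Longrightarrow> \<exists>g. v x = Fin g"
  by (cases "v x") (use v_neq_Minf[of x] v_eq_Pinf_iff[of x] in auto)

lemma v_sum_ge:
  assumes "\<And>i. i \<in> A \<Longrightarrow> f i \<in> F" "\<And>i. i \<in> A \<Longrightarrow> m \<le> v (f i)"
  shows "m \<le> v (sum f A)"
  using assms
proof (induction A rule: infinite_finite_induct)
  case (insert i A)
  then have "m \<le> min (v (f i)) (v (sum f A))"
    by simp
  also have "\<dots> \<le> v (f i + sum f A)"
    using insert by (intro v_add) simp_all
  finally show ?case
    using insert by simp
qed simp_all

text \<open>The bound has to differ from \<open>\<infinity>\<close> because the value
  \<open>\<infinity>\<close> of the empty sum must still exceed it.\<close>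

lemma v_sum_gt:
  assumes "\<And>i. i \<in> A \<Longrightarrow> f i \<in> F" "\<And>i. i \<in> A \<Longrightarrow> m < v (f i)" "m \<noteq> \<infinity>"
  shows "m < v (sum f A)"
  using assms(1,2)
proof (induction A rule: infinite_finite_induct)
  case (insert i A)
  then have "m < min (v (f i)) (v (sum f A))"
    by simp
  also have "\<dots> \<le> v (f i + sum f A)"
    using insert by (intro v_add) simp_all
  finally show ?case
    using insert by simp
qed (use assms(3) in \<open>cases m; simp\<close>)+

lemma v_sum_eq:
  assumes "finite A" "i \<in> A" "\<And>j. j \<in> A \<Longrightarrow> f j \<in> F"
    and "\<And>j. j \<in> A \<Longrightarrow> j \<noteq> i \<Longrightarrow> v (f i) < v (f j)" "f i \<noteq> 0"
  shows "v (sum f A) = v (f i)"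
proof -
  have "v (f i) < v (sum f (A - {i}))"
    using assms by (intro v_sum_gt) auto
  then have "v (f i + sum f (A - {i})) = v (f i)"
    using assms by (intro v_add_eq) (auto intro!: sum_mem)
  then show ?thesis
    using assms by (simp add: sum.remove)
qed

end

lemma valuation_iff: "valued_field (field_on F) v \<longleftrightarrow> valuation F v"
proof
  assume *: "valued_field (field_on F) v"
  then interpret subfield_set F
    by (intro subfield_set_field_on) (simp add: valued_field_def)
  show "valuation F v"
    by unfold_locales (use * in \<open>auto simp: valued_field_def\<close>)
next
  assume "valuation F v"
  then interpret valuation F v .
  show "valued_field (field_on F) v"
    using field_field_on v_mult v_add by (simp add: valued_field_def)
qed

lemma valuation_UNIV_iff: "valued_field whole_field v \<longleftrightarrow> valuation UNIV v"
  using valuation_iff[of UNIV v] by (simp add: field_on_UNIV)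

section \<open>Polynomials over a subfield\<close>

context subfield_set
begin

lemma polys_over_coeff: "p \<in> polys_over F \<Longrightarrow> Polynomial.coeff p i \<in> F"
  by (simp add: polys_over_def)

lemma polys_over_0 [simp]: "0 \<in> polys_over F"
  by (simp add: polys_over_def)

lemma polys_over_pCons [simp]: "pCons c p \<in> polys_over F \<longleftrightarrow> c \<in> F \<and> p \<in> polys_over F"
proof
  assume *: "pCons c p \<in> polys_over F"
  have "Polynomial.coeff (pCons c p) 0 \<in> F" "Polynomial.coeff (pCons c p) (Suc i) \<in> F" for i
    using * polys_over_coeff by blast+
  then show "c \<in> F \<and> p \<in> polys_over F"
    by (simp add: polys_over_def)
qed (auto simp: polys_over_def coeff_pCons split: nat.splits)

lemma polys_over_1 [simp]: "1 \<in> polys_over F"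
  unfolding one_pCons by (subst polys_over_pCons) simp

lemma polys_over_monom [simp]: "c \<in> F \<Longrightarrow> Polynomial.monom c n \<in> polys_over F"
  by (simp add: polys_over_def)

lemma polys_over_add [simp]: "p \<in> polys_over F \<Longrightarrow> q \<in> polys_over F \<Longrightarrow> p + q \<in> polys_over F"
  by (simp add: polys_over_def)

lemma polys_over_diff [simp]: "p \<in> polys_over F \<Longrightarrow> q \<in> polys_over F \<Longrightarrow> p - q \<in> polys_over F"
  by (simp add: polys_over_def)

lemma polys_over_smult [simp]: "c \<in> F \<Longrightarrow> p \<in> polys_over F \<Longrightarrow> Polynomial.smult c p \<in> polys_over F"
  by (simp add: polys_over_def)

lemma polys_over_mult [simp]: "p \<in> polys_over F \<Longrightarrow> q \<in> polys_over F \<Longrightarrow> p * q \<in> polys_over F"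
  by (simp add: polys_over_def coeff_mult)

declare polys_over_coeff [simp]

lemma polys_over_power [simp]: "p \<in> polys_over F \<Longrightarrow> p ^ n \<in> polys_over F"
  by (induction n) simp_all

lemma polys_over_sum [simp]: "(\<And>i. i \<in> A \<Longrightarrow> f i \<in> polys_over F) \<Longrightarrow> sum f A \<in> polys_over F"
  by (induction A rule: infinite_finite_induct) simp_all

text \<open>The coefficient of each partial quotient is a ratio of elements of \<open>F\<close>, so
  long division never leaves \<open>F\<close>. By uniqueness of division with remainder, the ambient
  \<open>div\<close> and \<open>mod\<close> then preserve \<open>polys_over F\<close>, and
  \<open>Q\<close>-adic digits stay over the base field.\<close>

lemma polys_over_division:
  assumes "p \<in> polys_over F" "q \<in> polys_over F" "q \<noteq> 0"
  shows "\<exists>s\<in>polys_over F. \<exists>r\<in>polys_over F.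
    p = s * q + r \<and> (r = 0 \<or> Polynomial.degree r < Polynomial.degree q)"
  using assms(1)
proof (induction "Polynomial.degree p" arbitrary: p rule: less_induct)
  case less
  show ?case
  proof (cases "p = 0 \<or> Polynomial.degree p < Polynomial.degree q")
    case True
    then have "p = 0 * q + p \<and> (p = 0 \<or> Polynomial.degree p < Polynomial.degree q)"
      by simp
    then show ?thesis
      using less.prems polys_over_0 by blast
  next
    case False
    define m where "m = Polynomial.monom (Polynomial.lead_coeff p / Polynomial.lead_coeff q)
      (Polynomial.degree p - Polynomial.degree q)"
    have m: "m \<in> polys_over F"
      unfolding m_def using less.prems assms by simp
    have deg: "Polynomial.degree (m * q) = Polynomial.degree p"
      unfolding m_def using False assms(3)
      by (subst degree_mult_eq) (auto simp: degree_monom_eq monom_eq_0_iff)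
    have lead: "Polynomial.coeff (m * q) (Polynomial.degree p) = Polynomial.lead_coeff p"
    proof -
      have "Polynomial.lead_coeff (m * q) = Polynomial.lead_coeff p"
        unfolding lead_coeff_mult
        using False assms(3) by (simp add: m_def degree_monom_eq)
      then show ?thesis
        by (simp add: deg)
    qed
    show ?thesis
    proof (cases "p - m * q = 0")
      case True
      then have "p = m * q + 0"
        by simp
      then show ?thesis
        using m polys_over_0 by blast
    next
      case nz: False
      have "Polynomial.degree (p - m * q) \<le> Polynomial.degree p"
        using degree_diff_le[of p "Polynomial.degree p" "m * q"] deg by simp
      moreover have "Polynomial.degree (p - m * q) \<noteq> Polynomial.degree p"
        using lead nz leading_coeff_0_iff[of "p - m * q"] by auto
      ultimately have "Polynomial.degree (p - m * q) < Polynomial.degree p"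
        by simp
      moreover have "p - m * q \<in> polys_over F"
        using m less.prems assms(2) by simp
      ultimately obtain s r where "s \<in> polys_over F" "r \<in> polys_over F"
        "p - m * q = s * q + r" "r = 0 \<or> Polynomial.degree r < Polynomial.degree q"
        using less.hyps by blast
      moreover from this have "p = (m + s) * q + r"
        by (simp add: algebra_simps)
      ultimately show ?thesis
        using m polys_over_add by blast
    qed
  qed
qed

lemma polys_over_div_mod:
  assumes "p \<in> polys_over F" "q \<in> polys_over F"
  shows "p div q \<in> polys_over F \<and> p mod q \<in> polys_over F"
proof (cases "q = 0")
  case False
  then obtain s r where *: "s \<in> polys_over F" "r \<in> polys_over F" "p = s * q + r"
    "r = 0 \<or> Polynomial.degree r < Polynomial.degree q"
    using polys_over_division[OF assms] by blast
  have "r div q = 0" "r mod q = r"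
    using *(4) by (auto simp: div_poly_less mod_poly_less)
  then show ?thesis
    using * False by (simp add: div_mult_self3)
qed (use assms in simp)

lemma polys_over_div [simp]: "p \<in> polys_over F \<Longrightarrow> q \<in> polys_over F \<Longrightarrow> p div q \<in> polys_over F"
  and polys_over_mod [simp]: "p \<in> polys_over F \<Longrightarrow> q \<in> polys_over F \<Longrightarrow> p mod q \<in> polys_over F"
  using polys_over_div_mod by auto

lemma subfield_set_ratfuncs_over: "subfield_set (ratfuncs_over F)"
proof
  have mem: "to_fract p / to_fract q \<in> ratfuncs_over F"
    if "p \<in> polys_over F" "q \<in> polys_over F" "q \<noteq> 0" for p q
    using that by (auto simp: ratfuncs_over_def)
  show "1 \<in> ratfuncs_over F"
    using mem[of 1 1] by simp
  fix x y assume "x \<in> ratfuncs_over F"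
  then obtain p q where x: "x = to_fract p / to_fract q" "p \<in> polys_over F" "q \<in> polys_over F" "q \<noteq> 0"
    by (auto simp: ratfuncs_over_def)
  show "inverse x \<in> ratfuncs_over F"
  proof (cases "p = 0")
    case True
    then show ?thesis
      using mem[of 0 1] x by simp
  next
    case False
    then show ?thesis
      using mem[of q p] x by (simp add: inverse_eq_divide)
  qed
  assume "y \<in> ratfuncs_over F"
  then obtain p' q' where y: "y = to_fract p' / to_fract q'" "p' \<in> polys_over F" "q' \<in> polys_over F"
      "q' \<noteq> 0"
    by (auto simp: ratfuncs_over_def)
  show "x - y \<in> ratfuncs_over F"
    using mem[of "p * q' - p' * q" "q * q'"] x y by (simp add: diff_frac_eq)
  show "x * y \<in> ratfuncs_over F"
    using mem[of "p * p'" "q * q'"] x y by simp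
qed

end

text \<open>Values are multiplicative, so this induction reduces assertions about all nonzero
  polynomials to constants and to the step of adding one root.\<close>

lemma poly_root_induct [consumes 1, case_names const linear]:
  fixes p :: "'a::alg_closed_field poly"
  assumes "p \<noteq> 0"
    and "\<And>c. c \<noteq> 0 \<Longrightarrow> P [:c:]"
    and "\<And>x q. q \<noteq> 0 \<Longrightarrow> P q \<Longrightarrow> P ([:-x, 1:] * q)"
  shows "P p"
  using assms(1)
proof (induction "Polynomial.degree p" arbitrary: p rule: less_induct)
  case less
  show ?case
  proof (cases "Polynomial.degree p = 0")
    case True
    then show ?thesis
      using assms(2) less.prems by (auto elim!: degree_eq_zeroE)
  next
    case False
    then obtain x where "poly p x = 0"
      using alg_closed_imp_poly_has_root[of p] by auto
    then obtain q where q: "p = [:-x, 1:] * q"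
      by (auto simp: poly_eq_0_iff_dvd elim: dvdE)
    then have "q \<noteq> 0"
      using less.prems by auto
    moreover from this have "Polynomial.degree q < Polynomial.degree p"
      unfolding q by (subst degree_mult_eq) auto
    ultimately show ?thesis
      using less.hyps assms(3) q by blast
  qed
qed

section \<open>Valuations of a polynomial ring and of its field of fractions\<close>

definition poly_valuation :: "('b::idom \<Rightarrow> 'g::linordered_ab_group_add extended) \<Rightarrow> bool" where
  "poly_valuation P \<longleftrightarrow> (\<forall>p. P p \<noteq> -\<infinity> \<and> (P p = \<infinity> \<longleftrightarrow> p = 0)) \<and>
     (\<forall>p q. P (p * q) = P p + P q) \<and> (\<forall>p q. min (P p) (P q) \<le> P (p + q))"

text \<open>The representing fraction is picked by choice; for a \<open>poly_valuation\<close>,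
  cross-multiplication shows that the difference is the same for all of them.\<close>

definition frac_val :: "('b::idom \<Rightarrow> 'g::linordered_ab_group_add extended) \<Rightarrow> 'b fract \<Rightarrow> 'g extended" where
  "frac_val P x = (let z = (SOME z. snd z \<noteq> 0 \<and> x = to_fract (fst z) / to_fract (snd z))
     in P (fst z) - P (snd z))"

lemma fract_obtain:
  obtains p q where "q \<noteq> 0" "x = to_fract p / to_fract q"
  by (cases x) (simp add: Fract_conv_to_fract)

lemma frac_val_divide:
  assumes "poly_valuation P" "q \<noteq> 0"
  shows "frac_val P (to_fract p / to_fract q) = P p - P q"
proof -
  define x where "x = to_fract p / to_fract q"
  define z where "z = (SOME z. snd z \<noteq> 0 \<and> x = to_fract (fst z) / to_fract (snd z))"
  have "\<exists>z. snd z \<noteq> 0 \<and> x = to_fract (fst z) / to_fract (snd z)"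
    using assms(2) by (intro exI[of _ "(p, q)"]) (simp add: x_def)
  then have z: "snd z \<noteq> 0" "x = to_fract (fst z) / to_fract (snd z)"
    unfolding z_def by (metis (mono_tags, lifting) someI_ex)+
  then have "to_fract (p * snd z) = to_fract (fst z * q)"
    using assms(2) by (simp add: x_def frac_eq_eq)
  then have "P (p * snd z) = P (fst z * q)"
    by (simp only: to_fract_eq_iff)
  then have "P p + P (snd z) = P (fst z) + P q"
    using assms(1) by (simp add: poly_valuation_def)
  moreover have "P (snd z) \<noteq> \<infinity>" "P q \<noteq> \<infinity>" "P p \<noteq> -\<infinity>" "P (fst z) \<noteq> -\<infinity>"
    "P (snd z) \<noteq> -\<infinity>" "P q \<noteq> -\<infinity>"
    using assms z(1) by (simp_all add: poly_valuation_def)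
  ultimately have "P (fst z) - P (snd z) = P p - P q"
    by (cases "P p"; cases "P (snd z)"; cases "P (fst z)"; cases "P q") (auto simp: algebra_simps)
  then show ?thesis
    by (simp add: frac_val_def Let_def z_def x_def)
qed

lemma frac_val_to_fract: "poly_valuation P \<Longrightarrow> frac_val P (to_fract p) = P p"
proof -
  assume *: "poly_valuation P"
  then have "P 1 + P 1 = P 1" "P 1 \<noteq> \<infinity>" "P 1 \<noteq> -\<infinity>"
    unfolding poly_valuation_def by (metis mult_1, simp, simp)
  then have "P 1 = Fin 0"
    by (cases "P 1") auto
  then have "P p - P 1 = P p"
    by (cases "P p") simp_all
  then show ?thesis
    using frac_val_divide[OF *, of 1 p] by simp
qed

lemma valuation_frac_val:
  assumes P: "poly_valuation P"
  shows "valuation UNIV (frac_val P)"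
proof
  fix x y :: "'a fract"
  obtain p q where x: "q \<noteq> 0" "x = to_fract p / to_fract q" by (rule fract_obtain)
  obtain p' q' where y: "q' \<noteq> 0" "y = to_fract p' / to_fract q'" by (rule fract_obtain)
  have fin: "P r \<noteq> -\<infinity>" "P r = \<infinity> \<longleftrightarrow> r = 0" "P (r * s) = P r + P s" "min (P r) (P s) \<le> P (r + s)" for r s
    using P by (simp_all add: poly_valuation_def)
  obtain g where g: "P q = Fin g"
    using fin[of q] x(1) by (cases "P q") auto
  obtain g' where g': "P q' = Fin g'"
    using fin[of q'] y(1) by (cases "P q'") auto
  have vx: "frac_val P x = P p - P q" and vy: "frac_val P y = P p' - P q'"
    using x y frac_val_divide[OF P] by simp_all
  show "frac_val P x \<noteq> -\<infinity>"
    using vx g fin(1)[of p] by (cases "P p") auto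
  show "(frac_val P x = \<infinity>) = (x = 0)"
    using vx g x fin(2)[of p] by (cases "P p") auto
  have "x * y = to_fract (p * p') / to_fract (q * q')"
    using x y by simp
  then have "frac_val P (x * y) = (P p + P p') - (P q + P q')"
    using frac_val_divide[OF P, of "q * q'" "p * p'"] x y fin(3) by simp
  then show "frac_val P (x * y) = frac_val P x + frac_val P y"
    using vx vy g g' fin(1)[of p] fin(1)[of p'] by (cases "P p"; cases "P p'") simp_all
  have "x + y = to_fract (p * q' + p' * q) / to_fract (q * q')"
    using x y by (simp add: add_frac_eq)
  then have *: "frac_val P (x + y) = P (p * q' + p' * q) - Fin (g + g')"
    using frac_val_divide[OF P, of "q * q'" "p * q' + p' * q"] x y fin(3) g g' by simp
  have "min (P p + P q') (P p' + P q) \<le> P (p * q' + p' * q)"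
    using fin(4)[of "p * q'" "p' * q"] fin(3) by simp
  then show "min (frac_val P x) (frac_val P y) \<le> frac_val P (x + y)"
    unfolding * vx vy g g' using fin(1)[of p] fin(1)[of p'] fin(1)[of "p * q' + p' * q"]
    by (cases "P p"; cases "P p'"; cases "P (p * q' + p' * q)")
      (auto simp: min_def algebra_simps split: if_splits)
qed simp_all

lemma fract_valuation_eqI:
  fixes u u' :: "'b::idom fract \<Rightarrow> 'g::linordered_ab_group_add extended"
  assumes "valuation UNIV u" "valuation UNIV u'" "\<And>p. u (to_fract p) = u' (to_fract p)"
  shows "u = u'"
proof
  fix x :: "'b fract"
  interpret u: valuation UNIV u by fact
  interpret u': valuation UNIV u' by fact
  obtain p q where x: "q \<noteq> 0" "x = to_fract p / to_fract q" by (rule fract_obtain)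
  have "u (to_fract q) + u x = u (to_fract q) + u' x"
    using u.v_divide_add[of "to_fract p" "to_fract q"] u'.v_divide_add[of "to_fract p" "to_fract q"]
      assms(3) x by simp
  then show "u x = u' x"
    using ext_add_cancel[of "u (to_fract q)" "u x" "u' x"] x(1) by simp
qed

section \<open>Gauss valuations\<close>

text \<open>This is the value of the monomial \<open>c_i X^i\<close> once \<open>X\<close> is given
  the value \<open>\<gamma>\<close>; \<open>gauss\<close> is the resulting monomial valuation
  centred at 0, and other centres are reached by composing with \<open>[:b, 1:]\<close>.\<close>

definition gauss_term :: "('a::field \<Rightarrow> 'g::linordered_ab_group_add extended) \<Rightarrow> 'g \<Rightarrow> 'a poly \<Rightarrow> nat \<Rightarrow> 'g extended" where
  "gauss_term w \<gamma> p i = w (Polynomial.coeff p i) + nat_mult i (Fin \<gamma>)"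

definition gauss :: "('a::field \<Rightarrow> 'g::linordered_ab_group_add extended) \<Rightarrow> 'g \<Rightarrow> 'a poly \<Rightarrow> 'g extended" where
  "gauss w \<gamma> p = Min (gauss_term w \<gamma> p ` {..Polynomial.degree p})"

text \<open>The last index at which the minimum is attained is additive on products.\<close>

definition lead_index :: "('a::field \<Rightarrow> 'g::linordered_ab_group_add extended) \<Rightarrow> 'g \<Rightarrow> 'a poly \<Rightarrow> nat \<Rightarrow> bool" where
  "lead_index w \<gamma> p d \<longleftrightarrow> gauss_term w \<gamma> p d = gauss w \<gamma> p \<and> (\<forall>i>d. gauss w \<gamma> p < gauss_term w \<gamma> p i)"

text \<open>These rules carry the finite contribution of \<open>X^k\<close> across an inequality,
  turning bounds on \<open>gauss_term\<close> into bounds on sums of coefficients and back.\<close>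

lemma Fin_less_add_Fin_iff:
  fixes x :: "'g::linordered_ab_group_add extended"
  shows "Fin (a - b) < x \<longleftrightarrow> Fin a < x + Fin b" "Fin (a - b) \<le> x \<longleftrightarrow> Fin a \<le> x + Fin b"
    "Fin (a - b) = x \<longleftrightarrow> Fin a = x + Fin b"
  by (cases x; auto simp: algebra_simps)+

locale total_valuation = valuation UNIV w for w :: "'a::field \<Rightarrow> 'g::linordered_ab_group_add extended"
begin

lemma gauss_term_eq_Pinf: "Polynomial.degree p < i \<Longrightarrow> gauss_term w \<gamma> p i = \<infinity>"
  by (simp add: gauss_term_def coeff_eq_0 ext_add_eq_Pinf_iff)

lemma gauss_term_eq_Pinf_iff: "gauss_term w \<gamma> p i = \<infinity> \<longleftrightarrow> Polynomial.coeff p i = 0"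
  by (simp add: gauss_term_def ext_add_eq_Pinf_iff)

lemma gauss_term_neq_Minf: "gauss_term w \<gamma> p i \<noteq> -\<infinity>"
  unfolding gauss_term_def by (rule ext_add_neq_Minf) simp_all

lemma gauss_le: "gauss w \<gamma> p \<le> gauss_term w \<gamma> p i"
  by (cases "i \<le> Polynomial.degree p") (simp_all add: gauss_def gauss_term_eq_Pinf)

lemma gauss_attained: "\<exists>i\<le>Polynomial.degree p. gauss_term w \<gamma> p i = gauss w \<gamma> p"
proof -
  have "gauss w \<gamma> p \<in> gauss_term w \<gamma> p ` {..Polynomial.degree p}"
    unfolding gauss_def by (rule Min_in) auto
  then show ?thesis by auto
qed

lemma gauss_ge: "(\<And>i. m \<le> gauss_term w \<gamma> p i) \<Longrightarrow> m \<le> gauss w \<gamma> p"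
  using gauss_attained[of p \<gamma>] by metis

lemma gauss_neq_Minf: "gauss w \<gamma> p \<noteq> -\<infinity>"
  using gauss_attained[of p \<gamma>] gauss_term_neq_Minf by metis

lemma gauss_eq_Pinf_iff: "gauss w \<gamma> p = \<infinity> \<longleftrightarrow> p = 0"
proof
  assume "gauss w \<gamma> p = \<infinity>"
  then have "gauss_term w \<gamma> p (Polynomial.degree p) = \<infinity>"
    using gauss_le[of \<gamma> p "Polynomial.degree p"] by simp
  then show "p = 0"
    by (simp add: gauss_term_eq_Pinf_iff)
qed (simp add: gauss_def gauss_term_def ext_add_eq_Pinf_iff)

lemma lead_index_ex:
  assumes "p \<noteq> 0"
  shows "\<exists>d. lead_index w \<gamma> p d"
proof -
  define S where "S = {i. i \<le> Polynomial.degree p \<and> gauss_term w \<gamma> p i = gauss w \<gamma> p}"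
  have S: "finite S" "S \<noteq> {}"
    using gauss_attained[of p \<gamma>] by (auto simp: S_def)
  \<comment> \<open>Indices beyond the degree are covered too: there the term is
    \<open>\<infinity>\<close>, while the minimum is finite because \<open>p\<close> is
    nonzero.\<close>
  have "gauss w \<gamma> p < gauss_term w \<gamma> p i" if "i > Max S" for i
  proof -
    have "i \<notin> S"
      using that S Max_ge[of S i] by auto
    moreover have "gauss w \<gamma> p \<noteq> \<infinity>"
      using assms by (simp add: gauss_eq_Pinf_iff)
    ultimately have "gauss_term w \<gamma> p i \<noteq> gauss w \<gamma> p"
      using gauss_term_eq_Pinf[of p i \<gamma>] by (cases "i \<le> Polynomial.degree p") (auto simp: S_def)
    then show ?thesis
      using gauss_le[of \<gamma> p i] by simp
  qed
  then show ?thesis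
    using Max_in[OF S] by (intro exI[of _ "Max S"]) (auto simp: lead_index_def S_def)
qed

lemma lead_index_nonzero: "lead_index w \<gamma> p d \<Longrightarrow> p \<noteq> 0"
  using gauss_eq_Pinf_iff[of \<gamma> p] by (auto simp: lead_index_def less_extended_def)

lemma gauss_term_mult_summand:
  assumes "i \<le> k"
  shows "w (Polynomial.coeff p i * Polynomial.coeff q (k - i)) + nat_mult k (Fin \<gamma>) =
    gauss_term w \<gamma> p i + gauss_term w \<gamma> q (k - i)"
  using nat_mult_add[of i "k - i" "Fin \<gamma>"] assms
  by (simp add: gauss_term_def v_mult ac_simps)

text \<open>This is the classical argument for Gauss's lemma. In the coefficient of index
  \<open>d + e\<close>, the summand made of the coefficients at \<open>d\<close> and
  \<open>e\<close> is the only one of minimal value, because every other summand has its first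
  factor beyond \<open>d\<close> or its second beyond \<open>e\<close>. Above \<open>d + e\<close>
  all summands are of that kind, so the last minimal index of the product is
  \<open>d + e\<close>.\<close>

lemma lead_index_mult:
  assumes p: "lead_index w \<gamma> p d" and q: "lead_index w \<gamma> q e"
  shows "gauss w \<gamma> (p * q) = gauss w \<gamma> p + gauss w \<gamma> q" "lead_index w \<gamma> (p * q) (d + e)"
proof -
  obtain a where a: "gauss w \<gamma> p = Fin a"
    using lead_index_nonzero[OF p] gauss_eq_Pinf_iff[of \<gamma> p] gauss_neq_Minf[of \<gamma> p]
    by (cases "gauss w \<gamma> p") auto
  obtain b where b: "gauss w \<gamma> q = Fin b"
    using lead_index_nonzero[OF q] gauss_eq_Pinf_iff[of \<gamma> q] gauss_neq_Minf[of \<gamma> q]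
    by (cases "gauss w \<gamma> q") auto
  define N where "N k = nat_mult k \<gamma>" for k
  have N: "nat_mult k (Fin \<gamma>) = Fin (N k)" for k
    by (simp add: N_def nat_mult_Fin)
  define t where "t k i = Polynomial.coeff p i * Polynomial.coeff q (k - i)" for k i
  have t: "w (t k i) + Fin (N k) = gauss_term w \<gamma> p i + gauss_term w \<gamma> q (k - i)" if "i \<le> k" for k i
    using gauss_term_mult_summand[OF that, of p q \<gamma>] by (simp add: t_def N)
  have gt: "gauss_term w \<gamma> (p * q) k = w (\<Sum>i\<le>k. t k i) + Fin (N k)" for k
    by (simp add: gauss_term_def t_def N coeff_mult)
  have strict: "Fin (a + b) < gauss_term w \<gamma> p i + gauss_term w \<gamma> q j" if "i > d \<or> j > e" for i j
    using that
  proof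
    assume "i > d"
    then have "Fin a < gauss_term w \<gamma> p i" "Fin b \<le> gauss_term w \<gamma> q j"
      using p gauss_le[of \<gamma> q j] by (auto simp: lead_index_def a b)
    then have "Fin a + Fin b < gauss_term w \<gamma> p i + gauss_term w \<gamma> q j"
      by (intro ext_add_less_le_mono) auto
    then show ?thesis by simp
  next
    assume "j > e"
    then have "Fin b < gauss_term w \<gamma> q j" "Fin a \<le> gauss_term w \<gamma> p i"
      using q gauss_le[of \<gamma> p i] by (auto simp: lead_index_def a b)
    then have "Fin b + Fin a < gauss_term w \<gamma> q j + gauss_term w \<gamma> p i"
      by (intro ext_add_less_le_mono) auto
    then show ?thesis by (simp add: ac_simps)
  qed
  have ge: "Fin (a + b) \<le> gauss_term w \<gamma> (p * q) k" for k
  proof -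
    have "Fin (a + b) \<le> gauss_term w \<gamma> p i + gauss_term w \<gamma> q (k - i)" for i
      using add_mono[OF gauss_le[of \<gamma> p i] gauss_le[of \<gamma> q "k - i"]] by (simp add: a b)
    then have "Fin (a + b - N k) \<le> w (t k i)" if "i \<le> k" for i
      using t[OF that] by (simp add: Fin_less_add_Fin_iff)
    then have "Fin (a + b - N k) \<le> w (\<Sum>i\<le>k. t k i)"
      by (intro v_sum_ge) auto
    then show ?thesis
      by (simp add: gt Fin_less_add_Fin_iff)
  qed
  have gtr: "Fin (a + b) < gauss_term w \<gamma> (p * q) k" if k: "k > d + e" for k
  proof -
    have "Fin (a + b - N k) < w (t k i)" if i: "i \<le> k" for i
    proof -
      have "i > d \<or> k - i > e"
        using k i by linarith
      then show ?thesis
        using strict[of i "k - i"] t[OF i] by (simp add: Fin_less_add_Fin_iff)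
    qed
    then have "Fin (a + b - N k) < w (\<Sum>i\<le>k. t k i)"
      by (intro v_sum_gt) auto
    then show ?thesis
      by (simp add: gt Fin_less_add_Fin_iff)
  qed
  have td: "w (t (d + e) d) = Fin (a + b - N (d + e))"
    using t[of d "d + e"] p q a b
    by (auto simp: lead_index_def Fin_less_add_Fin_iff(3) intro!: sym[of "Fin _"])
  have "w (\<Sum>i\<le>d+e. t (d + e) i) = w (t (d + e) d)"
  proof (rule v_sum_eq)
    fix i assume i: "i \<in> {..d + e}" "i \<noteq> d"
    then have "i > d \<or> d + e - i > e"
      by auto
    then show "w (t (d + e) d) < w (t (d + e) i)"
      unfolding td using strict[of i "d + e - i"] t[of i "d + e"] i
      by (simp add: Fin_less_add_Fin_iff)
  next
    show "t (d + e) d \<noteq> 0"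
      using td v_eq_Pinf_iff[of "t (d + e) d"] by auto
  qed auto
  then have eq: "gauss_term w \<gamma> (p * q) (d + e) = Fin (a + b)"
    by (simp add: gt td)
  have "gauss w \<gamma> (p * q) \<le> Fin (a + b)"
    using gauss_le[of \<gamma> "p * q" "d + e"] eq by simp
  moreover have "Fin (a + b) \<le> gauss w \<gamma> (p * q)"
    by (rule gauss_ge) (rule ge)
  ultimately have "gauss w \<gamma> (p * q) = Fin (a + b)"
    by simp
  then show "gauss w \<gamma> (p * q) = gauss w \<gamma> p + gauss w \<gamma> q" "lead_index w \<gamma> (p * q) (d + e)"
    using eq gtr by (auto simp: lead_index_def a b)
qed

lemma gauss_mult: "gauss w \<gamma> (p * q) = gauss w \<gamma> p + gauss w \<gamma> q"
proof (cases "p = 0 \<or> q = 0")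
  case True
  then show ?thesis
    using gauss_eq_Pinf_iff[of \<gamma> p] gauss_eq_Pinf_iff[of \<gamma> q] gauss_eq_Pinf_iff[of \<gamma> "p * q"]
    by (auto simp: ext_add_eq_Pinf_iff)
next
  case False
  then show ?thesis
    using lead_index_ex lead_index_mult(1) by metis
qed

lemma gauss_add: "min (gauss w \<gamma> p) (gauss w \<gamma> q) \<le> gauss w \<gamma> (p + q)"
proof (rule gauss_ge)
  fix i
  have "min (gauss w \<gamma> p) (gauss w \<gamma> q) \<le> min (gauss_term w \<gamma> p i) (gauss_term w \<gamma> q i)"
    using gauss_le[of \<gamma> p i] gauss_le[of \<gamma> q i] by (meson min.mono)
  also have "\<dots> = min (w (Polynomial.coeff p i)) (w (Polynomial.coeff q i)) + nat_mult i (Fin \<gamma>)"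
    unfolding gauss_term_def by (auto simp: min_def ext_add_le_cancel add.commute)
  also have "\<dots> \<le> w (Polynomial.coeff (p + q) i) + nat_mult i (Fin \<gamma>)"
    by (intro add_right_mono) (simp add: v_add)
  finally show "min (gauss w \<gamma> p) (gauss w \<gamma> q) \<le> gauss_term w \<gamma> (p + q) i"
    by (simp add: gauss_term_def)
qed

lemma lead_index_power:
  assumes "lead_index w \<gamma> p d"
  shows "lead_index w \<gamma> (p ^ n) (n * d)"
proof (induction n)
  case 0
  have "gauss w \<gamma> 1 = 0" "gauss_term w \<gamma> 1 0 = 0"
    by (simp_all add: gauss_def gauss_term_def)
  moreover have "gauss_term w \<gamma> 1 i = \<infinity>" if "i > 0" for i
    using that by (intro gauss_term_eq_Pinf) simp
  ultimately show ?case
    by (auto simp: lead_index_def zero_extended_def)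
next
  case (Suc n)
  then show ?case
    using lead_index_mult(2)[OF assms Suc] by simp
qed

lemma lead_index_const: "c \<noteq> 0 \<Longrightarrow> lead_index w \<gamma> [:c:] 0"
  using v_finite[of c]
  by (auto simp: lead_index_def gauss_def gauss_term_def coeff_pCons ext_add_eq_Pinf_iff split: nat.splits)

lemma gauss_const: "gauss w \<gamma> [:c:] = w c"
  by (simp add: gauss_def gauss_term_def)

lemma gauss_linear: "gauss w \<gamma> [:c, 1:] = min (w c) (Fin \<gamma>)"
proof -
  have "{..Suc 0} = {0, 1}" by auto
  then show ?thesis
    by (simp add: gauss_def gauss_term_def nat_mult_Suc zero_extended_def)
qed

text \<open>A tie goes to index 1, since the last minimum counts. Index 0 therefore detects exactly
  the roots whose distance from the centre has value strictly below \<open>\<gamma>\<close>.\<close>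

lemma lead_index_linear: "lead_index w \<gamma> [:c, 1:] (if w c < Fin \<gamma> then 0 else 1)"
proof -
  have 0: "gauss_term w \<gamma> [:c, 1:] 0 = w c" and 1: "gauss_term w \<gamma> [:c, 1:] 1 = Fin \<gamma>"
    by (simp_all add: gauss_term_def nat_mult_Suc zero_extended_def)
  have 2: "gauss_term w \<gamma> [:c, 1:] i = \<infinity>" if "i > 1" for i
    using that by (intro gauss_term_eq_Pinf) simp
  have fin: "min (w c) (Fin \<gamma>) < \<infinity>"
    by (cases "w c") auto
  show ?thesis
  proof (cases "w c < Fin \<gamma>")
    case True
    have "w c < gauss_term w \<gamma> [:c, 1:] i" if "i > 0" for i
    proof (cases "i = 1")
      case False
      then show ?thesis using 2[of i] that fin True by (auto simp: min_def split: if_splits)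
    qed (use True 1 in simp)
    then show ?thesis
      using True 0 by (auto simp: lead_index_def gauss_linear min_def)
  next
    case False
    then show ?thesis
      using 1 2 by (auto simp: lead_index_def gauss_linear min_def)
  qed
qed

lemma poly_valuation_gauss_shift: "poly_valuation (\<lambda>p. gauss w \<gamma> (pcompose p [:a, 1:]))"
  unfolding poly_valuation_def
  by (simp add: gauss_mult gauss_add gauss_neq_Minf gauss_eq_Pinf_iff pcompose_mult pcompose_add
      pcompose_eq_0_iff)

text \<open>Existence comes from extending the shifted Gauss valuation to fractions, uniqueness from
  the fact that polynomials determine a valuation of their fraction field. Shifting keeps the
  degree, so the minimum in the definition runs over the right indices.\<close>

lemma monomial_valuation:
  shows "valuation UNIV (monomial_valuation w a \<gamma>)"
    and "monomial_valuation w a \<gamma> (to_fract p) = gauss w \<gamma> (pcompose p [:a, 1:])"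
proof -
  define P where "P p = gauss w \<gamma> (pcompose p [:a, 1:])" for p
  have P: "poly_valuation P"
    unfolding P_def by (rule poly_valuation_gauss_shift)
  have P_eq: "P p = Min ((\<lambda>i. w (Polynomial.coeff (pcompose p [:a, 1:]) i) + nat_mult i (Fin \<gamma>))
               ` {..Polynomial.degree p})" for p
    by (simp add: P_def gauss_def gauss_term_def[abs_def] degree_pcompose)
  have "monomial_valuation w a \<gamma> = frac_val P"
    unfolding monomial_valuation_def valuation_UNIV_iff P_eq[symmetric]
    using valuation_frac_val[OF P] frac_val_to_fract[OF P]
    by (intro the_equality fract_valuation_eqI) auto
  then show "valuation UNIV (monomial_valuation w a \<gamma>)"
    "monomial_valuation w a \<gamma> (to_fract p) = gauss w \<gamma> (pcompose p [:a, 1:])"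
    using valuation_frac_val[OF P] frac_val_to_fract[OF P] by (simp_all add: P_def)
qed

end

lemma ext_add_less_cancel:
  fixes a b c :: "'g::linordered_ab_group_add extended"
  assumes "c \<noteq> \<infinity>" "c \<noteq> -\<infinity>"
  shows "a + c < b + c \<longleftrightarrow> a < b"
  using ext_add_le_cancel[OF assms, of b a] by (simp add: add.commute not_le[symmetric])

section \<open>Key polynomials and truncations\<close>

text \<open>Splitting off \<open>n\<close> digits leaves \<open>f div Q ^ n\<close> as the factor of
  \<open>Q ^ n\<close>; for \<open>n = degree f + 1\<close> this quotient vanishes because
  \<open>Q\<close> is nonconstant.\<close>

lemma adic_expansion:
  fixes f Q :: "'a::field poly"
  assumes "Polynomial.degree Q > 0"
  shows "f = (\<Sum>i\<le>Polynomial.degree f. ((f div Q ^ i) mod Q) * Q ^ i)"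
proof -
  have step: "f = (\<Sum>i<n. ((f div Q ^ i) mod Q) * Q ^ i) + (f div Q ^ n) * Q ^ n" for n
  proof (induction n)
    case (Suc n)
    have "f div Q ^ n = (f div Q ^ n) mod Q + (f div Q ^ Suc n) * Q"
      using div_mult_mod_eq[of "f div Q ^ n" Q]
      by (simp add: poly_div_mult_right mult.commute[of Q] add.commute)
    then have "(f div Q ^ n) * Q ^ n = ((f div Q ^ n) mod Q) * Q ^ n + (f div Q ^ Suc n) * Q ^ Suc n"
      by (metis (no_types, lifting) distrib_right mult.assoc power_Suc)
    then show ?case
      using Suc by (simp add: add.assoc)
  qed simp
  have "Q \<noteq> 0"
    using assms by auto
  then have "Polynomial.degree (Q ^ Suc (Polynomial.degree f)) = Suc (Polynomial.degree f) * Polynomial.degree Q"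
    by (rule degree_power_eq)
  also have "\<dots> > Polynomial.degree f"
    using assms by (cases "Polynomial.degree Q") auto
  finally have "f div Q ^ Suc (Polynomial.degree f) = 0"
    by (rule div_poly_less)
  then show ?thesis
    using step[of "Suc (Polynomial.degree f)"] by (simp add: lessThan_Suc_atMost)
qed

text \<open>Distinct values of \<open>\<delta>\<close> already make the order total, so
  wellfoundedness of the strict part is all that remains. In this form a new top element can be
  added easily.\<close>

lemma well_order_on_delta_iff:
  assumes "\<forall>Q\<in>\<Lambda>. \<forall>Q'\<in>\<Lambda>. Q \<noteq> Q' \<longrightarrow> delta v Q \<noteq> delta v Q'"
  shows "well_order_on \<Lambda> {(Q, Q'). Q \<in> \<Lambda> \<and> Q' \<in> \<Lambda> \<and> (Q = Q' \<or> delta v Q < delta v Q')} \<longleftrightarrow>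
    wf {(Q, Q'). Q \<in> \<Lambda> \<and> Q' \<in> \<Lambda> \<and> delta v Q < delta v Q'}"
proof -
  let ?R = "{(Q, Q'). Q \<in> \<Lambda> \<and> Q' \<in> \<Lambda> \<and> (Q = Q' \<or> delta v Q < delta v Q')}"
  have "delta v x < delta v y \<or> delta v y < delta v x" if "x \<in> \<Lambda>" "y \<in> \<Lambda>" "x \<noteq> y" for x y
    using assms that by (meson linorder_neqE)
  then have "linear_order_on \<Lambda> ?R"
    unfolding order_on_defs
    by (auto simp: refl_on_def trans_def antisym_def total_on_def)
  moreover have "?R - Id = {(Q, Q'). Q \<in> \<Lambda> \<and> Q' \<in> \<Lambda> \<and> delta v Q < delta v Q'}"
    by auto
  ultimately show ?thesis
    by (simp add: well_order_on_def)
qed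

text \<open>Agreement below the threshold \<open>z\<close>, with both quantities at least
  \<open>z\<close> otherwise, is what truncation at \<open>z\<close> can see. The application has
  \<open>x = w (b - c)\<close>, \<open>y = X_val c\<close> and \<open>z = X_val b\<close>.\<close>

lemma min_eq_of_ultrametric:
  fixes x y z :: "'c::linorder"
  assumes "y < z \<longrightarrow> x = y" "z \<le> y \<longrightarrow> z \<le> x"
  shows "min x z = min y z" "x < z \<longleftrightarrow> y < z"
proof -
  have "min x z = min y z \<and> (x < z \<longleftrightarrow> y < z)"
  proof (cases "y < z")
    case True
    then show ?thesis using assms(1) by simp
  next
    case False
    then have "z \<le> y" "z \<le> x" using assms(2) by simp_all
    then have "\<not> x < z" "\<not> y < z" "min x z = z" "min y z = z"
      by (simp_all only: not_less min.absorb2)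
    then show ?thesis by simp
  qed
  then show "min x z = min y z" "x < z \<longleftrightarrow> y < z" by blast+
qed

locale fract_valuation = valuation UNIV u
  for u :: "'a::alg_closed_field poly fract \<Rightarrow> 'g::linordered_ab_group_add extended"
begin

abbreviation w :: "'a \<Rightarrow> 'g extended" where
  "w c \<equiv> u (const_fract c)"

abbreviation X_val :: "'a \<Rightarrow> 'g extended" where
  "X_val c \<equiv> u (X_fract - const_fract c)"

sublocale const: total_valuation w
proof
  fix x y :: 'a
  have "[:x + y:] = [:x:] + [:y:]" "[:x * y:] = [:x:] * [:y:]"
    by simp_all
  then show "w (x * y) = w x + w y" "min (w x) (w y) \<le> w (x + y)"
    using v_mult[of "const_fract x" "const_fract y"] v_add[of "const_fract x" "const_fract y"]
    by (simp_all only: to_fract_mult to_fract_add UNIV_I)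
qed simp_all

lemma X_minus_const: "X_fract - const_fract c = to_fract [:-c, 1:]"
  unfolding to_fract_diff[symmetric] by simp

lemma X_val_finite: "\<exists>g. X_val c = Fin g"
  unfolding X_minus_const by (rule v_finite) simp_all

lemma X_val_linear_mult: "u (to_fract ([:-c, 1:] * q)) = X_val c + u (to_fract q)"
  unfolding X_minus_const by (simp only: to_fract_mult v_mult UNIV_I)

lemma w_diff: "w (b - c) = u ((X_fract - const_fract c) - (X_fract - const_fract b))"
  unfolding to_fract_diff[symmetric] by simp

text \<open>As \<open>b - c\<close> is the difference of \<open>X - c\<close> and
  \<open>X - b\<close>, the ultrametric inequality makes \<open>X\<close> and \<open>b\<close>
  indistinguishable up to the value \<open>X_val b\<close>. This lets a root \<open>b\<close> act as
  a centre in place of \<open>X\<close>.\<close>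

lemma min_w_diff: "min (w (b - c)) (X_val b) = min (X_val c) (X_val b)"
  and w_diff_less_iff: "w (b - c) < X_val b \<longleftrightarrow> X_val c < X_val b"
proof -
  have *: "X_val c < X_val b \<longrightarrow> w (b - c) = X_val c"
    unfolding w_diff by (intro impI v_diff_eq) simp_all
  have "X_val b \<le> X_val c \<longrightarrow> X_val b \<le> w (b - c)"
    unfolding w_diff using v_diff[of "X_fract - const_fract c" "X_fract - const_fract b"]
    by (auto simp: min.absorb2)
  from min_eq_of_ultrametric[OF * this]
  show "min (w (b - c)) (X_val b) = min (X_val c) (X_val b)"
    "w (b - c) < X_val b \<longleftrightarrow> X_val c < X_val b" .
qed

lemma X_val_le_delta: "f \<noteq> 0 \<Longrightarrow> poly f c = 0 \<Longrightarrow> X_val c \<le> delta u f"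
  unfolding delta_def by (intro Max_ge) (auto intro: poly_roots_finite)

lemma delta_attained:
  assumes "Polynomial.degree f > 0"
  obtains c where "poly f c = 0" "X_val c = delta u f"
proof -
  have "f \<noteq> 0"
    using assms by auto
  then have "delta u f \<in> X_val ` {c. poly f c = 0}"
    unfolding delta_def using alg_closed_imp_poly_has_root[OF assms]
    by (intro Max_in) (auto intro: poly_roots_finite)
  then show ?thesis
    using that by auto
qed

lemma delta_le_iff:
  assumes "Polynomial.degree f > 0"
  shows "delta u f \<le> m \<longleftrightarrow> (\<forall>c. poly f c = 0 \<longrightarrow> X_val c \<le> m)"
proof -
  have "f \<noteq> 0"
    using assms by auto
  then have "X_val c \<le> delta u f" if "poly f c = 0" for c
    using that by (rule X_val_le_delta)
  moreover obtain c where "poly f c = 0" "X_val c = delta u f"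
    using assms by (rule delta_attained)
  ultimately show ?thesis
    by (auto intro: order_trans)
qed

text \<open>
  Let \<open>b\<close> be a root of \<open>Q\<close> with \<open>v(X - b) = \<delta>(Q)\<close>.  The Gauss valuation \<open>V\<close> centred at \<open>b\<close> with
  radius \<open>\<delta>(Q)\<close> replaces every \<open>v(X - c)\<close> by \<open>min (v(X - c)) (\<delta>(Q))\<close>, so \<open>V f = v f\<close> means
  \<open>\<delta>(f) \<le> \<delta>(Q)\<close>.  On the other hand \<open>V\<close> is the truncation at \<open>Q\<close>: the coefficients of the
  \<open>Q\<close>-adic expansion have leading index 0 and \<open>Q\<close> has positive leading index, so the terms of
  minimal value cannot cancel.
\<close>

lemma gauss_shift_le:
  assumes b: "X_val b = Fin \<gamma>" and "g \<noteq> 0"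
  shows "gauss w \<gamma> (pcompose g [:b, 1:]) \<le> u (to_fract g) \<and>
    (gauss w \<gamma> (pcompose g [:b, 1:]) = u (to_fract g) \<longleftrightarrow> (\<forall>c. poly g c = 0 \<longrightarrow> X_val c \<le> Fin \<gamma>))"
  using assms(2)
proof (induction g rule: poly_root_induct)
  case (const c)
  then show ?case
    by (simp add: const.gauss_const)
next
  case (linear x q)
  let ?V = "\<lambda>g. gauss w \<gamma> (pcompose g [:b, 1:])"
  have "pcompose [:-x, 1:] [:b, 1:] = [:b - x, 1:]"
    by (simp add: pcompose_pCons)
  then have V: "?V ([:-x, 1:] * q) = min (X_val x) (Fin \<gamma>) + ?V q"
    using min_w_diff[of b x] b by (simp add: pcompose_mult const.gauss_mult const.gauss_linear del: mult_pCons_left)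
  obtain g where g: "X_val x = Fin g"
    using X_val_finite by blast
  obtain a where a: "u (to_fract q) = Fin a"
    using v_finite[of "to_fract q"] linear(1) by auto
  have "?V q \<noteq> \<infinity>" "?V q \<noteq> -\<infinity>"
    using linear(1) const.gauss_eq_Pinf_iff[of \<gamma> "pcompose q [:b, 1:]"] const.gauss_neq_Minf
    by (simp_all add: pcompose_eq_0_iff)
  then obtain a' where a': "?V q = Fin a'"
    by (cases "?V q") auto
  have "a' \<le> a" "a' = a \<longleftrightarrow> (\<forall>c. poly q c = 0 \<longrightarrow> X_val c \<le> Fin \<gamma>)"
    using linear(2) a a' by simp_all
  \<comment> \<open>Each factor can only lose value under truncation, and a sum of two inequalities
    is an equality only if both are. Hence the equivalence survives the addition of a root.\<close>
  moreover have "min g \<gamma> + a' = g + a \<longleftrightarrow> g \<le> \<gamma> \<and> a' = a" if "a' \<le> a"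
    using that add_less_le_mono[of \<gamma> g a' a]  by (auto simp: min_def not_le)
  moreover have "min g \<gamma> + a' \<le> g + a" if "a' \<le> a"
    using that by (intro add_mono) simp_all
  ultimately show ?case
    unfolding V X_val_linear_mult g a a' using g
    by (auto simp del: mult_pCons_left)
qed

text \<open>After the shift, a root \<open>x\<close> with \<open>X_val x\<close> below
  \<open>\<gamma>\<close> gives the factor \<open>X + (b - x)\<close>, in which the constant term
  alone is minimal. Leading indices add up, so they stay 0 in the product.\<close>

lemma gauss_shift_lead_index_0:
  assumes b: "X_val b = Fin \<gamma>" and "g \<noteq> 0"
  shows "(\<And>c. poly g c = 0 \<Longrightarrow> X_val c < Fin \<gamma>) \<Longrightarrow> lead_index w \<gamma> (pcompose g [:b, 1:]) 0"
  using assms(2)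
proof (induction g rule: poly_root_induct)
  case (const c)
  then show ?case
    by (simp add: const.lead_index_const)
next
  case (linear x q)
  have "pcompose [:-x, 1:] [:b, 1:] = [:b - x, 1:]"
    by (simp add: pcompose_pCons)
  moreover have "w (b - x) < Fin \<gamma>"
    using linear(3)[of x] w_diff_less_iff[of b x] b by simp
  ultimately have "lead_index w \<gamma> (pcompose [:-x, 1:] [:b, 1:]) 0"
    using const.lead_index_linear[of \<gamma> "b - x"] by simp
  moreover have "lead_index w \<gamma> (pcompose q [:b, 1:]) 0"
    using linear by (auto intro!: linear(2))
  ultimately show ?case
    using const.lead_index_mult(2) by (simp add: pcompose_mult del: mult_pCons_left) (metis add_0)
qed

lemma gauss_shift_eq_truncation:
  assumes F: "subfield_set F" and Q: "key_poly F u Q" and f: "f \<in> polys_over F" "f \<noteq> 0"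
    and b: "poly Q b = 0" "X_val b = delta u Q" "X_val b = Fin \<gamma>"
  shows "gauss w \<gamma> (pcompose f [:b, 1:]) = truncation u Q f"
proof -
  interpret F: subfield_set F by fact
  have QF: "Q \<in> polys_over F" and degQ: "Polynomial.degree Q > 0"
    and key: "\<And>g. g \<in> polys_over F \<Longrightarrow> Polynomial.degree g > 0 \<Longrightarrow>
      Polynomial.degree g < Polynomial.degree Q \<Longrightarrow> delta u g < delta u Q"
    using Q by (auto simp: key_poly_def)
  have Q0: "Q \<noteq> 0"
    using degQ by auto
  define n where "n = Polynomial.degree f"
  define s where "s g = pcompose g [:b, 1:]" for g
  have s_mult: "s (g * h) = s g * s h" and s_power: "s (g ^ i) = s g ^ i" for g h i
  proof -
    show *: "s (g * h) = s g * s h" for g h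
      by (simp add: s_def pcompose_mult)
    show "s (g ^ i) = s g ^ i"
      by (induction i) (simp_all add: * , simp add: s_def pcompose_1)
  qed
  define V where "V g = gauss w \<gamma> (s g)" for g
  have V_mult: "V (g * h) = V g + V h" and V_0: "V 0 = \<infinity>" for g h
    by (simp_all add: V_def s_mult const.gauss_mult, simp_all add: s_def const.gauss_eq_Pinf_iff)
  define c where "c i = (f div Q ^ i) mod Q" for i
  have c_mem: "c i \<in> polys_over F" for i
    using f QF by (simp add: c_def)
  \<comment> \<open>A digit has smaller degree than \<open>Q\<close>, so the key property keeps all
    of its roots strictly below the radius \<open>\<delta>(Q)\<close>.\<close>
  have c_small: "X_val z < Fin \<gamma>" if "c i \<noteq> 0" "poly (c i) z = 0" for i z
  proof -
    have "Polynomial.degree (c i) > 0"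
      using that by (metis degree_0_id gr0I poly_0 poly_const_conv pCons_eq_0_iff degree_eq_zeroE)
    moreover have "Polynomial.degree (c i) < Polynomial.degree Q"
      using degree_mod_less'[OF Q0] that(1) by (simp add: c_def)
    ultimately have "delta u (c i) < delta u Q"
      using key c_mem by blast
    then show ?thesis
      using X_val_le_delta[OF that] b by simp
  qed
  have Vc: "V (c i) = u (to_fract (c i))" for i
  proof (cases "c i = 0")
    case False
    then show ?thesis
      using gauss_shift_le[OF b(3) False] c_small[OF False] by (auto simp: V_def s_def less_imp_le)
  qed (simp add: V_0)
  have VQ: "V Q = u (to_fract Q)"
    using gauss_shift_le[OF b(3) Q0] X_val_le_delta[OF Q0] b by (auto simp: V_def s_def)
  \<comment> \<open>The shift moves the root \<open>b\<close> of \<open>Q\<close> to 0, and the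
    resulting factor \<open>X\<close> contributes 1 to the leading index.\<close>
  obtain k where k: "lead_index w \<gamma> (s Q) k" "k \<ge> 1"
  proof -
    obtain q where q: "Q = [:-b, 1:] * q"
      using b(1) by (auto simp: poly_eq_0_iff_dvd elim: dvdE)
    then have "s q \<noteq> 0"
      using Q0 by (auto simp: s_def pcompose_eq_0_iff)
    then obtain e where "lead_index w \<gamma> (s q) e"
      using const.lead_index_ex by blast
    moreover have "s [:-b, 1:] = [:0, 1:]"
      by (simp add: s_def pcompose_pCons)
    then have "lead_index w \<gamma> (s [:-b, 1:]) 1"
      using const.lead_index_linear[of \<gamma> 0] by simp
    ultimately have "lead_index w \<gamma> (s Q) (1 + e)"
      unfolding q s_mult by (intro const.lead_index_mult)
    then show ?thesis
      using that[of "1 + e"] by simp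
  qed
  define t where "t i = c i * Q ^ i" for i
  have Vt: "V (t i) = u (to_fract (c i)) + nat_mult i (u (to_fract Q))" for i
  proof -
    have "V (Q ^ i) = nat_mult i (V Q)"
    proof (induction i)
      case 0
      show ?case
        by (simp add: V_def s_def pcompose_1 one_pCons const.gauss_const del: pCons_one)
    qed (simp add: V_mult nat_mult_Suc)
    then show ?thesis
      by (simp add: t_def V_mult Vc VQ)
  qed
  have lead_t: "lead_index w \<gamma> (s (t i)) (i * k)" if "c i \<noteq> 0" for i
  proof -
    have "lead_index w \<gamma> (s (c i)) 0"
      unfolding s_def using c_small[OF that] by (intro gauss_shift_lead_index_0[OF b(3) that]) auto
    then show ?thesis
      using const.lead_index_mult(2) const.lead_index_power[OF k(1)]
      by (simp add: t_def s_mult s_power) (metis add_0)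
  qed
  define T where "T = truncation u Q f"
  have T_eq: "T = Min ((\<lambda>i. V (t i)) ` {..n})"
    by (simp add: T_def truncation_def Vt c_def n_def)
  have T_le: "T \<le> V (t i)" if "i \<le> n" for i
    unfolding T_eq using that by (intro Min_le) auto
  have f_eq: "f = (\<Sum>i\<le>n. t i)"
    using adic_expansion[OF degQ, of f] by (simp add: t_def c_def n_def)
  interpret V: valuation UNIV "monomial_valuation w b \<gamma>"
    by (rule const.monomial_valuation)
  have V_eq: "monomial_valuation w b \<gamma> (to_fract g) = V g" for g
    by (simp add: const.monomial_valuation V_def s_def)
  have ge: "T \<le> V f"
  proof -
    have "T \<le> monomial_valuation w b \<gamma> (\<Sum>i\<le>n. to_fract (t i))"
      using T_le by (intro V.v_sum_ge) (auto simp: V_eq)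
    then show ?thesis
      by (subst f_eq) (simp add: V_eq[symmetric])
  qed
  have "s f \<noteq> 0"
    using f by (simp add: s_def pcompose_eq_0_iff)
  then have T_fin: "T \<noteq> \<infinity>"
    using ge const.gauss_eq_Pinf_iff[of \<gamma> "s f"] by (auto simp: V_def)
  \<comment> \<open>Among the terms of minimal value, the one with the largest index
    \<open>m\<close> is singled out. The leading index of the \<open>i\<close>-th term is
    \<open>i * k\<close> and \<open>k\<close> is positive, so in the coefficient at
    \<open>m * k\<close> only this term reaches the value \<open>T\<close>.\<close>
  define S where "S = {i. i \<le> n \<and> V (t i) = T}"
  have "finite S"
    by (simp add: S_def)
  moreover have "T \<in> (\<lambda>i. V (t i)) ` {..n}"
    unfolding T_eq by (rule Min_in) auto
  then have "S \<noteq> {}"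
    by (auto simp: S_def)
  ultimately have Max_S: "Max S \<in> S" "\<And>i. i \<in> S \<Longrightarrow> i \<le> Max S"
    by simp_all
  define m where "m = Max S"
  have m: "m \<le> n" "V (t m) = T"
    using Max_S(1) by (simp_all add: S_def m_def)
  define j where "j = m * k"
  have c_nz: "c i \<noteq> 0" if "V (t i) = T" for i
    using that T_fin V_0 by (auto simp: t_def)
  have term_m: "gauss_term w \<gamma> (s (t m)) j = T"
    using lead_t[OF c_nz[OF m(2)]] m(2) by (simp add: lead_index_def j_def V_def)
  have term_i: "T < gauss_term w \<gamma> (s (t i)) j" if i: "i \<le> n" "i \<noteq> m" for i
  proof (cases "V (t i) = T")
    case True
    then have "i \<in> S"
      using i by (simp add: S_def)
    then have "i < m"
      using Max_S(2)[of i] i(2) by (simp add: m_def)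
    then have "i * k < j"
      using k(2) by (simp add: j_def)
    then show ?thesis
      using lead_t[OF c_nz[OF True]] True by (simp add: lead_index_def V_def)
  next
    case False
    then have "T < V (t i)"
      using T_le[OF i(1)] by simp
    then show ?thesis
      using const.gauss_le[of \<gamma> "s (t i)" j] by (simp add: V_def)
  qed
  have "w (\<Sum>i\<le>n. Polynomial.coeff (s (t i)) j) = w (Polynomial.coeff (s (t m)) j)"
  proof (rule const.v_sum_eq)
    fix i assume "i \<in> {..n}" "i \<noteq> m"
    then have "gauss_term w \<gamma> (s (t m)) j < gauss_term w \<gamma> (s (t i)) j"
      using term_i[of i] term_m by simp
    then show "w (Polynomial.coeff (s (t m)) j) < w (Polynomial.coeff (s (t i)) j)"
      by (simp add: gauss_term_def ext_add_less_cancel)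
  next
    show "Polynomial.coeff (s (t m)) j \<noteq> 0"
      using const.gauss_term_eq_Pinf_iff[of \<gamma> "s (t m)" j] term_m T_fin by simp
  qed (use m in auto)
  moreover have "s f = (\<Sum>i\<le>n. s (t i))"
    unfolding s_def by (subst f_eq) (rule pcompose_sum)
  ultimately have "gauss_term w \<gamma> (s f) j = T"
    using term_m by (simp add: gauss_term_def coeff_sum)
  then have "V f \<le> T"
    using const.gauss_le[of \<gamma> "s f" j] by (simp add: V_def)
  then show ?thesis
    using ge by (simp add: V_def s_def T_def)
qed

lemma truncation_eq_iff:
  assumes "subfield_set F" "key_poly F u Q" "f \<in> polys_over F" "Polynomial.degree f > 0"
  shows "u (to_fract f) = truncation u Q f \<longleftrightarrow> delta u f \<le> delta u Q"
proof -
  have "Polynomial.degree Q > 0"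
    using assms(2) by (simp add: key_poly_def)
  then obtain b where b: "poly Q b = 0" "X_val b = delta u Q"
    by (rule delta_attained)
  obtain \<gamma> where \<gamma>: "X_val b = Fin \<gamma>"
    using X_val_finite by blast
  have f0: "f \<noteq> 0"
    using assms(4) by auto
  have "delta u Q = Fin \<gamma>"
    using b \<gamma> by simp
  then have "delta u f \<le> delta u Q \<longleftrightarrow> gauss w \<gamma> (pcompose f [:b, 1:]) = u (to_fract f)"
    using gauss_shift_le[OF \<gamma> f0] delta_le_iff[OF assms(4), of "Fin \<gamma>"] by (simp only:)
  then show ?thesis
    unfolding gauss_shift_eq_truncation[OF assms(1-3) f0 b \<gamma>] by (simp only: eq_commute)
qed

end

section \<open>Approximation over a dense subfield\<close>

locale dense_subfields = total_valuation w + K: subfield_set K + L: subfield_set L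
  for w :: "'a::alg_closed_field \<Rightarrow> 'g::linordered_ab_group_add extended" and K L :: "'a set" +
  assumes K_subset_L: "K \<subseteq> L"
    and dense: "x \<in> L \<Longrightarrow> y \<in> L \<Longrightarrow> y \<noteq> 0 \<Longrightarrow> \<exists>b\<in>K. w y < w (x - b)"
    and algebraic: "algebraic_closure_of L = UNIV"
begin

lemma polys_over_K_subset: "polys_over K \<subseteq> polys_over L"
  unfolding polys_over_def using K_subset_L by blast

text \<open>If \<open>w x\<close> exceeded all values of \<open>L\<close>, then in an equation
  \<open>p(x) = 0\<close> over \<open>L\<close> the lowest nonvanishing term would have strictly
  smallest value: each further power of \<open>x\<close> raises the value by more than any ratio of
  coefficients can lower it. Such a sum cannot vanish.\<close>

lemma cofinal:
  assumes "x \<noteq> 0"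
  shows "\<exists>y\<in>L. y \<noteq> 0 \<and> w x \<le> w y"
proof (rule ccontr)
  assume "\<not> ?thesis"
  then have less: "w y < w x" if "y \<in> L" "y \<noteq> 0" for y
    using that by (auto simp: not_le)
  have pos: "0 \<le> w x"
    using less[of 1] by simp
  have pos_power: "0 \<le> w (x ^ n)" for n
  proof (induction n)
    case (Suc n)
    then show ?case
      using add_mono[OF pos Suc] by (simp add: v_mult)
  qed simp
  have le_power: "w x \<le> w (x ^ Suc n)" for n
    using add_left_mono[OF pos_power[of n], of "w x"] by (simp add: v_mult)
  obtain p where p: "p \<in> polys_over L" "p \<noteq> 0" "poly p x = 0"
    using algebraic unfolding algebraic_closure_of_def by blast
  define i where "i = (LEAST i. Polynomial.coeff p i \<noteq> 0)"
  have ci: "Polynomial.coeff p i \<noteq> 0" and below: "\<And>j. j < i \<Longrightarrow> Polynomial.coeff p j = 0"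
    using LeastI_ex[of "\<lambda>i. Polynomial.coeff p i \<noteq> 0"] p(2) not_less_Least
    by (auto simp: i_def poly_eq_iff)
  have "w (poly p x) = w (Polynomial.coeff p i * x ^ i)"
    unfolding poly_altdef
  proof (rule v_sum_eq)
    show "i \<in> {..Polynomial.degree p}"
      using ci le_degree by auto
    show nz: "Polynomial.coeff p i * x ^ i \<noteq> 0"
      using ci assms by simp
    fix j assume j: "j \<noteq> i"
    show "w (Polynomial.coeff p i * x ^ i) < w (Polynomial.coeff p j * x ^ j)"
    proof (cases "Polynomial.coeff p j = 0")
      case True
      have "w (Polynomial.coeff p i * x ^ i) < \<infinity>"
        using v_finite[OF UNIV_I nz] by auto
      then show ?thesis
        using True by simp
    next
      case False
      then have "j > i"
        using below[of j] j by (cases "j < i") auto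
      then obtain k where k: "j = i + Suc k"
        using less_imp_Suc_add by auto
      define r where "r = Polynomial.coeff p i / Polynomial.coeff p j"
      have r: "r \<in> L" "r \<noteq> 0" "Polynomial.coeff p i = Polynomial.coeff p j * r"
        using False ci p(1) by (simp_all add: r_def)
      have "w r < w (x ^ Suc k)"
        using less[OF r(1,2)] le_power[of k] by simp
      moreover have "Polynomial.coeff p i * x ^ i = (Polynomial.coeff p j * x ^ i) * r"
        "Polynomial.coeff p j * x ^ j = (Polynomial.coeff p j * x ^ i) * x ^ Suc k"
        using r(3) k by (simp_all add: power_add)
      moreover have "w (Polynomial.coeff p j * x ^ i) \<noteq> \<infinity>"
        using False assms by simp
      ultimately show ?thesis
        by (simp only: v_mult UNIV_I) (intro ext_add_less_mono; simp add: v_mult ext_add_eq_Pinf_iff ext_add_neq_Minf)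
    qed
  qed simp_all
  then show False
    using p(3) ci assms v_eq_Pinf_iff[of "Polynomial.coeff p i * x ^ i"] by simp
qed

lemma dense_cofinal:
  assumes "x \<in> L" "y \<noteq> 0"
  shows "\<exists>b\<in>K. w y < w (x - b)"
proof -
  obtain z where z: "z \<in> L" "z \<noteq> 0" "w y \<le> w z"
    using cofinal[OF assms(2)] by blast
  then obtain b where "b \<in> K" "w z < w (x - b)"
    using dense[OF assms(1)] by blast
  then show ?thesis
    using z(3) le_less_trans by blast
qed

text \<open>Factorisation makes the value of \<open>f\<close> at \<open>x\<close> the sum of
  \<open>w (x - c)\<close> over the roots. It is applied contrapositively: a very large value at
  \<open>x\<close> forces a root close to \<open>x\<close>. The induction carries the leading
  coefficient because its base case is an arbitrary constant.\<close>

lemma monic_value_le: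
  assumes "Polynomial.lead_coeff f = 1" "\<And>c. poly f c = 0 \<Longrightarrow> w (x - c) \<le> w y"
  shows "w (poly f x) \<le> w (y ^ Polynomial.degree f)"
proof -
  have "f \<noteq> 0"
    using assms(1) by auto
  then have "(\<forall>c. poly f c = 0 \<longrightarrow> w (x - c) \<le> w y) \<longrightarrow>
    w (poly f x) \<le> w (Polynomial.lead_coeff f) + w (y ^ Polynomial.degree f)"
  proof (induction f rule: poly_root_induct)
    case (linear c q)
    show ?case
    proof
      assume *: "\<forall>z. poly ([:-c, 1:] * q) z = 0 \<longrightarrow> w (x - z) \<le> w y"
      have "w (poly q x) \<le> w (Polynomial.lead_coeff q) + w (y ^ Polynomial.degree q)"
        using linear * by auto
      moreover have "w (x - c) \<le> w y"
        using * by auto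
      ultimately have "w (x - c) + w (poly q x) \<le> w y + (w (Polynomial.lead_coeff q) + w (y ^ Polynomial.degree q))"
        by (intro add_mono)
      moreover have "poly ([:-c, 1:] * q) x = (x - c) * poly q x"
        unfolding poly_mult by (simp add: algebra_simps)
      moreover have "Polynomial.degree ([:-c, 1:] * q) = Suc (Polynomial.degree q)"
        using linear(1) by (subst degree_mult_eq) auto
      moreover have "Polynomial.lead_coeff ([:-c, 1:] * q) = Polynomial.lead_coeff q"
        by (simp only: lead_coeff_mult) simp
      ultimately show "w (poly ([:-c, 1:] * q) x) \<le>
        w (Polynomial.lead_coeff ([:-c, 1:] * q)) + w (y ^ Polynomial.degree ([:-c, 1:] * q))"
        by (simp only: v_mult UNIV_I power_Suc) (simp only: ac_simps)
    qed
  qed simp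
  then show ?thesis
    using assms by simp
qed

text \<open>Continuity of roots in quantitative form: the lower coefficients are approximated until
  \<open>f'\<close> at \<open>x\<close> has value above \<open>w (y ^ d)\<close>, and then not every
  root of \<open>f'\<close> can satisfy \<open>w (x - c) \<le> w y\<close>.\<close>

lemma approximate_root_monic:
  assumes f: "f \<in> polys_over L" "Polynomial.lead_coeff f = 1" "poly f x = 0" and "y \<noteq> 0"
  obtains f' c where "f' \<in> polys_over K" "Polynomial.degree f' = Polynomial.degree f"
    "poly f' c = 0" "w y < w (x - c)"
proof -
  define d where "d = Polynomial.degree f"
  have "\<exists>b\<in>K. w (y ^ d) < w ((b - Polynomial.coeff f i) * x ^ i)" for i
  proof -
    \<comment> \<open>The error in the \<open>i\<close>-th coefficient gets multiplied by
      \<open>x ^ i\<close>, so the target \<open>y ^ d\<close> is divided by that power. For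
      \<open>x = 0\<close> only the constant coefficient matters, the other errors being
      annihilated.\<close>
    define t where "t = (if x = 0 then y ^ d else y ^ d / x ^ i)"
    have "t \<noteq> 0"
      using \<open>y \<noteq> 0\<close> by (simp add: t_def)
    then obtain b where b: "b \<in> K" "w t < w (Polynomial.coeff f i - b)"
      using dense_cofinal[of "Polynomial.coeff f i" t] f(1) by auto
    have b': "w t < w (b - Polynomial.coeff f i)"
      using b(2) v_diff_commute[of b "Polynomial.coeff f i"] by simp
    have "w (y ^ d) < w ((b - Polynomial.coeff f i) * x ^ i)"
    proof (cases "x = 0")
      case True
      have "w (y ^ d) < \<infinity>"
        using v_finite[of "y ^ d"] \<open>y \<noteq> 0\<close> by auto
      then show ?thesis
        using True b' by (cases i) (simp_all add: t_def)
    next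
      case False
      have "w (x ^ i) + w t < w (x ^ i) + w (b - Polynomial.coeff f i)"
        using b' False by (intro ext_add_less_mono) simp_all
      then show ?thesis
        using False by (simp add: v_mult[symmetric] t_def mult.commute)
    qed
    then show ?thesis
      using b(1) by blast
  qed
  then obtain b where b: "\<And>i. b i \<in> K" "\<And>i. w (y ^ d) < w ((b i - Polynomial.coeff f i) * x ^ i)"
    by metis
  define g where "g = (\<Sum>i<d. Polynomial.monom (b i) i)"
  define f' where "f' = Polynomial.monom 1 d + g"
  have g_coeff: "Polynomial.coeff g i = (if i < d then b i else 0)" for i
    by (simp add: g_def coeff_sum if_distrib cong: if_cong)
  have lead: "Polynomial.coeff f' d = 1"
    by (simp add: f'_def g_coeff)
  have "Polynomial.degree f' \<le> d"
    by (rule degree_le) (auto simp: f'_def g_coeff)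
  then have deg: "Polynomial.degree f' = d"
    using lead le_degree[of f' d] by simp
  have mem: "f' \<in> polys_over K"
    using b(1) by (simp add: f'_def g_def)
  have split: "{..d} = insert d {..<d}"
    by auto
  have "poly f' x = poly f' x - poly f x"
    using f(3) by simp
  also have "\<dots> = (\<Sum>i\<le>d. (Polynomial.coeff f' i - Polynomial.coeff f i) * x ^ i)"
    by (simp add: poly_altdef deg d_def[symmetric] sum_subtractf algebra_simps)
  also have "\<dots> = (\<Sum>i<d. (b i - Polynomial.coeff f i) * x ^ i)"
    using f(2) by (simp add: split lead d_def[symmetric]) (simp add: f'_def g_coeff)
  finally have "w (y ^ d) < w (poly f' x)"
    using b(2) \<open>y \<noteq> 0\<close> by (simp only:) (intro v_sum_gt; simp)
  then obtain c where "poly f' c = 0" "w y < w (x - c)"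
    using monic_value_le[of f' x y] lead deg by (metis leD not_le)
  then show ?thesis
    using that mem deg d_def by blast
qed

lemma approximate_root:
  assumes f: "f \<in> polys_over L" "f \<noteq> 0" "poly f x = 0" and "y \<noteq> 0"
  obtains f' c where "f' \<in> polys_over K" "Polynomial.degree f' = Polynomial.degree f"
    "poly f' c = 0" "w y < w (x - c)"
proof -
  define g where "g = Polynomial.smult (inverse (Polynomial.lead_coeff f)) f"
  have "g \<in> polys_over L" "Polynomial.lead_coeff g = 1" "poly g x = 0"
    "Polynomial.degree g = Polynomial.degree f"
    using f by (simp_all add: g_def)
  then show ?thesis
    using that approximate_root_monic[OF _ _ _ \<open>y \<noteq> 0\<close>, of g x] by metis
qed

end

locale dense_fract_valuation = fract_valuation u + dense_subfields "\<lambda>c. u (const_fract c)" K L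
  for u :: "'a::alg_closed_field poly fract \<Rightarrow> 'g::linordered_ab_group_add extended" and K L :: "'a set"
begin

text \<open>The root \<open>x\<close> realising \<open>\<delta>(f)\<close> is replaced by a root
  \<open>c\<close> closer to \<open>x\<close> than \<open>X\<close> is, and then \<open>X\<close> is
  at least as close to \<open>c\<close> as to \<open>x\<close>. The bound by \<open>w y\<close> says
  how close is close enough.\<close>

lemma approximate_delta:
  assumes f: "f \<in> polys_over L" "Polynomial.degree f > 0" and y: "y \<noteq> 0" "delta u f \<le> w y"
  obtains f' where "f' \<in> polys_over K" "Polynomial.degree f' = Polynomial.degree f"
    "delta u f \<le> delta u f'"
proof -
  have "f \<noteq> 0"
    using f by auto
  obtain x where x: "poly f x = 0" "X_val x = delta u f"
    using f(2) by (rule delta_attained)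
  obtain f' c where f': "f' \<in> polys_over K" "Polynomial.degree f' = Polynomial.degree f"
    "poly f' c = 0" "w y < w (x - c)"
    using approximate_root[OF f(1) \<open>f \<noteq> 0\<close> x(1) y(1)] by metis
  have "X_val x < w (x - c)"
    using x(2) y(2) f'(4) by (simp add: le_less_trans)
  then have "X_val x \<le> X_val c"
    using w_diff_less_iff[of x c] by (metis less_asym not_le)
  also have "\<dots> \<le> delta u f'"
    using f' f(2) by (intro X_val_le_delta) auto
  finally show ?thesis
    using that f' x(2) by metis
qed

text \<open>The bound on \<open>\<delta>\<close> is asked only below the degree of \<open>Q\<close>.
  In the algebraic case it fails for the minimal polynomial of \<open>\<alpha>\<close> but holds in
  all smaller degrees.\<close>

lemma key_poly_dense:
  assumes Q: "key_poly K u Q"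
    and bound: "\<And>f. f \<in> polys_over L \<Longrightarrow> Polynomial.degree f > 0 \<Longrightarrow>
      Polynomial.degree f < Polynomial.degree Q \<Longrightarrow> \<exists>y. y \<noteq> 0 \<and> delta u f \<le> w y"
  shows "key_poly L u Q"
  unfolding key_poly_def
proof (intro conjI ballI impI)
  show "Q \<in> polys_over L"
    using Q polys_over_K_subset by (auto simp: key_poly_def)
  fix f assume f: "f \<in> polys_over L"
    "Polynomial.degree f > 0 \<and> Polynomial.degree f < Polynomial.degree Q"
  then obtain y where "y \<noteq> 0" "delta u f \<le> w y"
    using bound by blast
  then obtain f' where "f' \<in> polys_over K" "Polynomial.degree f' = Polynomial.degree f"
    "delta u f \<le> delta u f'"
    using approximate_delta f by metis
  moreover from this have "delta u f' < delta u Q"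
    using Q f(2) by (simp add: key_poly_def)
  ultimately show "delta u f < delta u Q"
    by (simp add: le_less_trans)
qed (use Q in \<open>auto simp: key_poly_def\<close>)

text \<open>The member of \<open>\<Lambda>\<close> found for an approximant over \<open>K\<close>
  also serves \<open>f\<close>, since the approximant has the same degree and at least the same
  \<open>\<delta>\<close>.\<close>

lemma complete_key_sequence_dense:
  assumes \<Lambda>: "complete_key_sequence K u \<Lambda>"
    and f: "f \<in> polys_over L" "Polynomial.degree f > 0" and y: "y \<noteq> 0" "delta u f \<le> w y"
  obtains Q where "Q \<in> \<Lambda>" "Polynomial.degree Q \<le> Polynomial.degree f" "delta u f \<le> delta u Q"
proof -
  obtain f' where f': "f' \<in> polys_over K" "Polynomial.degree f' = Polynomial.degree f"
    "delta u f \<le> delta u f'"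
    using approximate_delta[OF f y] .
  then obtain Q where Q: "Q \<in> \<Lambda>" "Polynomial.degree Q \<le> Polynomial.degree f'"
    "u (to_fract f') = truncation u Q f'"
    using \<Lambda> f(2) unfolding complete_key_sequence_def by metis
  then have "delta u f' \<le> delta u Q"
    using truncation_eq_iff[OF K.subfield_set_axioms, of Q f'] \<Lambda> f' f(2)
    by (auto simp: complete_key_sequence_def)
  then show ?thesis
    using that Q f' by (metis order_trans)
qed

end

lemma less_succ_index: "\<nu> < succ_index (\<nu> :: 'i::{wellorder,no_top})"
  unfolding succ_index_def using gt_ex by (rule LeastI_ex)

text \<open>Here \<open>v\<close> lives over \<open>Kbar\<close> and \<open>w\<close> on the ambient
  field, and they agree on \<open>Kbar\<close>. A common extension to all rational functions is not
  part of the data; each case constructs one, in Case II after enlarging the value group.\<close>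

locale rational_extension = dense_subfields w K L
  for w :: "'a::alg_closed_field \<Rightarrow> 'g::linordered_ab_group_add extended" and K L :: "'a set" +
  fixes v :: "'a poly fract \<Rightarrow> 'g extended"
  assumes v_valuation: "valuation (ratfuncs_over (algebraic_closure_of K)) v"
    and w_eq: "c \<in> algebraic_closure_of K \<Longrightarrow> w c = v (const_fract c)"
begin

abbreviation Kbar :: "'a set" where
  "Kbar \<equiv> algebraic_closure_of K"

abbreviation X_val :: "'a \<Rightarrow> 'g extended" where
  "X_val c \<equiv> v (X_fract - const_fract c)"

sublocale V: valuation "ratfuncs_over Kbar" v
  by (rule v_valuation)

lemma root_mem_Kbar: "f \<in> polys_over K \<Longrightarrow> f \<noteq> 0 \<Longrightarrow> poly f c = 0 \<Longrightarrow> c \<in> Kbar"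
  by (auto simp: algebraic_closure_of_def)

lemma K_subset_Kbar: "c \<in> K \<Longrightarrow> c \<in> Kbar"
  by (rule root_mem_Kbar[of "[:-c, 1:]"]) simp_all

lemma to_fract_mem: "p \<in> polys_over Kbar \<Longrightarrow> to_fract p \<in> ratfuncs_over Kbar"
proof -
  assume "p \<in> polys_over Kbar"
  moreover have "1 \<in> polys_over Kbar"
    using K_subset_Kbar[of 0] K_subset_Kbar[of 1] unfolding polys_over_def by (auto simp: coeff_1)
  ultimately show ?thesis
    unfolding ratfuncs_over_def by (intro CollectI exI[of _ p] exI[of _ 1]) simp
qed

lemma const_mem: "c \<in> Kbar \<Longrightarrow> const_fract c \<in> ratfuncs_over Kbar"
  using K_subset_Kbar[of 0]
  by (intro to_fract_mem) (auto simp: polys_over_def coeff_pCons split: nat.splits)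

lemma X_minus_const_mem: "c \<in> Kbar \<Longrightarrow> X_fract - const_fract c \<in> ratfuncs_over Kbar"
  using K_subset_Kbar[of 0] K_subset_Kbar[of 1]
  by (intro V.diff_mem const_mem to_fract_mem) (auto simp: polys_over_def coeff_pCons split: nat.splits)

lemma X_minus_const_neq_0: "X_fract - const_fract c \<noteq> 0"
  unfolding to_fract_diff[symmetric] to_fract_eq_0_iff by simp

lemma X_val_finite: "c \<in> Kbar \<Longrightarrow> \<exists>g. X_val c = Fin g"
  using X_minus_const_mem X_minus_const_neq_0 by (intro V.v_finite)

text \<open>
  Reading off the leading coefficients of a fraction that represents \<open>c - d\<close> writes it as a quotient
  of elements of \<open>Kbar\<close>; this avoids a proof that \<open>Kbar\<close> is a field.
\<close>

lemma v_const_diff: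
  assumes "c \<in> Kbar" "d \<in> Kbar"
  shows "v (const_fract c - const_fract d) = w (c - d)"
proof -
  have eq: "const_fract c - const_fract d = const_fract (c - d)"
    unfolding to_fract_diff[symmetric] by simp
  have mem: "const_fract (c - d) \<in> ratfuncs_over Kbar"
    unfolding eq[symmetric] using assms by (intro V.diff_mem const_mem)
  then obtain p q where pq: "const_fract (c - d) = to_fract p / to_fract q"
    "p \<in> polys_over Kbar" "q \<in> polys_over Kbar" "q \<noteq> 0"
    unfolding ratfuncs_over_def by blast
  have "to_fract ([:c - d:] * q) = const_fract (c - d) * to_fract q"
    by (simp only: to_fract_mult)
  also have "\<dots> = to_fract p"
    using pq(4) unfolding pq(1) by simp
  finally have "to_fract ([:c - d:] * q) = to_fract p" .
  then have "[:c - d:] * q = p"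
    by (simp only: to_fract_eq_iff)
  then have "Polynomial.smult (c - d) q = p"
    by simp
  then have *: "(c - d) * Polynomial.lead_coeff q = Polynomial.coeff p (Polynomial.degree q)"
    by auto
  have lq: "Polynomial.lead_coeff q \<in> Kbar" "Polynomial.coeff p (Polynomial.degree q) \<in> Kbar"
    using pq unfolding polys_over_def by auto
  have "const_fract (c - d) * const_fract (Polynomial.lead_coeff q) =
    const_fract (Polynomial.coeff p (Polynomial.degree q))"
    unfolding to_fract_mult[symmetric] *[symmetric] by simp
  then have "v (const_fract (c - d)) + v (const_fract (Polynomial.lead_coeff q)) =
    w ((c - d) * Polynomial.lead_coeff q)"
    unfolding * w_eq[OF lq(2)] using V.v_mult[OF mem const_mem[OF lq(1)]] by simp
  then have "w (Polynomial.lead_coeff q) + v (const_fract (c - d)) = w (Polynomial.lead_coeff q) + w (c - d)"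
    by (simp add: v_mult w_eq[OF lq(1)] add.commute)
  then show ?thesis
    unfolding eq using pq(4) by (subst (asm) ext_add_cancel) simp_all
qed

lemma w_diff_eq_X_val_diff:
  assumes "c \<in> Kbar" "d \<in> Kbar"
  shows "w (c - d) = v ((X_fract - const_fract d) - (X_fract - const_fract c))"
  using v_const_diff[OF assms] by simp

lemma w_diff_eq_X_val:
  assumes "c \<in> Kbar" "d \<in> Kbar" "X_val c < X_val d"
  shows "w (c - d) = X_val c" "w (d - c) = X_val c"
  using V.v_diff_eq[OF X_minus_const_mem[OF assms(1)] X_minus_const_mem[OF assms(2)] assms(3)]
  by (simp_all only: w_diff_eq_X_val_diff assms)

subsection \<open>Transfer along an order embedding of value groups\<close>

context
  fixes \<phi> :: "'g extended \<Rightarrow> 'h::linordered_ab_group_add extended"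
    and u :: "'a poly fract \<Rightarrow> 'h extended"
  assumes mono: "strict_mono \<phi>"
    and hom: "\<And>x y. \<phi> (x + y) = \<phi> x + \<phi> y" "\<phi> 0 = 0" "\<phi> \<infinity> = \<infinity>"
    and u: "valuation UNIV u"
    and u_const: "\<And>c. u (const_fract c) = \<phi> (w c)"
    and u_X: "\<And>c. c \<in> Kbar \<Longrightarrow> u (X_fract - const_fract c) = \<phi> (X_val c)"
begin

interpretation U: fract_valuation u
  using u by (simp add: fract_valuation_def)

lemma dense_fract_valuation_transfer: "dense_fract_valuation u K L"
proof -
  have "\<phi> x < \<phi> y \<longleftrightarrow> x < y" for x y
    using mono by (simp add: strict_mono_less)
  then show ?thesis
    using dense K_subset_L algebraic
    by (unfold_locales) (simp_all add: u_const)
qed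

text \<open>Membership in \<open>ratfuncs_over Kbar\<close> is proved alongside, because
  multiplicativity of \<open>v\<close> is available only there.\<close>

lemma split_over_Kbar_transfer:
  assumes "p \<noteq> 0"
  shows "(\<forall>c. poly p c = 0 \<longrightarrow> c \<in> Kbar) \<longrightarrow> Polynomial.lead_coeff p \<in> Kbar \<longrightarrow>
    to_fract p \<in> ratfuncs_over Kbar \<and> u (to_fract p) = \<phi> (v (to_fract p))"
  using assms
proof (induction p rule: poly_root_induct)
  case (const c)
  then show ?case
    using const_mem[of c] w_eq[of c] u_const[of c] by simp
next
  case (linear x q)
  show ?case
  proof (intro impI)
    assume *: "\<forall>c. poly ([:-x, 1:] * q) c = 0 \<longrightarrow> c \<in> Kbar" "Polynomial.lead_coeff ([:-x, 1:] * q) \<in> Kbar"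
    have "Polynomial.lead_coeff ([:-x, 1:] * q) = Polynomial.lead_coeff q"
      by (simp only: lead_coeff_mult) simp
    then have q: "to_fract q \<in> ratfuncs_over Kbar" "u (to_fract q) = \<phi> (v (to_fract q))"
      using linear * by auto
    have x: "x \<in> Kbar"
      using * by auto
    have eq: "to_fract ([:-x, 1:] * q) = (X_fract - const_fract x) * to_fract q"
      by (simp only: to_fract_mult U.X_minus_const)
    show "to_fract ([:-x, 1:] * q) \<in> ratfuncs_over Kbar \<and>
      u (to_fract ([:-x, 1:] * q)) = \<phi> (v (to_fract ([:-x, 1:] * q)))"
      unfolding eq using q X_minus_const_mem[OF x] u_X[OF x]
      by (simp add: V.v_mult U.v_mult hom)
  qed
qed

lemma poly_transfer:
  assumes "f \<in> polys_over K"
  shows "u (to_fract f) = \<phi> (v (to_fract f))"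
proof (cases "f = 0")
  case False
  then show ?thesis
    using split_over_Kbar_transfer[OF False] root_mem_Kbar[OF assms False] K_subset_Kbar assms by simp
qed (simp add: hom)

lemma delta_transfer:
  assumes "f \<in> polys_over K" "Polynomial.degree f > 0"
  shows "delta u f = \<phi> (delta v f)"
proof -
  have f0: "f \<noteq> 0"
    using assms(2) by auto
  let ?R = "{c. poly f c = 0}"
  have "delta u f = Max (\<phi> ` (X_val ` ?R))"
    unfolding delta_def image_image using root_mem_Kbar[OF assms(1) f0]
    by (intro arg_cong[of _ _ Max] image_cong) (auto intro: u_X)
  also have "\<dots> = \<phi> (Max (X_val ` ?R))"
    using mono poly_roots_finite[OF f0] alg_closed_imp_poly_has_root[OF assms(2)]
    by (intro mono_Max_commute[symmetric] strict_mono_mono) auto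
  finally show ?thesis
    by (simp add: delta_def)
qed

lemma truncation_transfer:
  assumes "f \<in> polys_over K" "Q \<in> polys_over K"
  shows "truncation u Q f = \<phi> (truncation v Q f)"
proof -
  have nat_mult: "nat_mult i (\<phi> x) = \<phi> (nat_mult i x)" for i x
    by (induction i) (simp_all add: nat_mult_Suc hom)
  let ?t = "\<lambda>i. v (to_fract ((f div Q ^ i) mod Q)) + nat_mult i (v (to_fract Q))"
  have "truncation u Q f = Min (\<phi> ` (?t ` {..Polynomial.degree f}))"
    unfolding truncation_def image_image using assms
    by (simp add: poly_transfer nat_mult hom)
  also have "\<dots> = \<phi> (Min (?t ` {..Polynomial.degree f}))"
    using mono by (intro mono_Min_commute[symmetric] strict_mono_mono) auto
  finally show ?thesis
    by (simp add: truncation_def)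
qed

lemma complete_key_sequence_transfer:
  assumes "complete_key_sequence K v \<Lambda>"
  shows "complete_key_sequence K u \<Lambda>"
proof -
  have less: "\<phi> x < \<phi> y \<longleftrightarrow> x < y" and eq: "\<phi> x = \<phi> y \<longleftrightarrow> x = y" for x y
    using mono by (simp_all add: strict_mono_less strict_mono_eq)
  have v_key: "\<And>Q. Q \<in> \<Lambda> \<Longrightarrow> key_poly K v Q"
    and v_distinct: "\<forall>Q\<in>\<Lambda>. \<forall>Q'\<in>\<Lambda>. Q \<noteq> Q' \<longrightarrow> delta v Q \<noteq> delta v Q'"
    and v_wo: "well_order_on \<Lambda> {(Q, Q'). Q \<in> \<Lambda> \<and> Q' \<in> \<Lambda> \<and> (Q = Q' \<or> delta v Q < delta v Q')}"
    and v_complete: "\<forall>f\<in>polys_over K. Polynomial.degree f > 0 \<longrightarrow>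
      (\<exists>Q\<in>\<Lambda>. Polynomial.degree Q \<le> Polynomial.degree f \<and> v (to_fract f) = truncation v Q f)"
    using assms unfolding complete_key_sequence_def by blast+
  have d: "delta u Q = \<phi> (delta v Q)" and mem: "Q \<in> polys_over K" if "Q \<in> \<Lambda>" for Q
    using v_key[OF that] delta_transfer by (auto simp: key_poly_def)
  have key: "key_poly K u Q" if "Q \<in> \<Lambda>" for Q
    using v_key[OF that] unfolding key_poly_def by (simp add: d[OF that] delta_transfer less)
  have distinct: "\<forall>Q\<in>\<Lambda>. \<forall>Q'\<in>\<Lambda>. Q \<noteq> Q' \<longrightarrow> delta u Q \<noteq> delta u Q'"
    using v_distinct by (simp add: d eq)
  have "{(Q, Q'). Q \<in> \<Lambda> \<and> Q' \<in> \<Lambda> \<and> (Q = Q' \<or> delta u Q < delta u Q')} =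
    {(Q, Q'). Q \<in> \<Lambda> \<and> Q' \<in> \<Lambda> \<and> (Q = Q' \<or> delta v Q < delta v Q')}"
    using d less by auto
  then have wo: "well_order_on \<Lambda> {(Q, Q'). Q \<in> \<Lambda> \<and> Q' \<in> \<Lambda> \<and> (Q = Q' \<or> delta u Q < delta u Q')}"
    using v_wo by simp
  have complete: "\<exists>Q\<in>\<Lambda>. Polynomial.degree Q \<le> Polynomial.degree f \<and> u (to_fract f) = truncation u Q f"
    if f: "f \<in> polys_over K" "Polynomial.degree f > 0" for f
  proof -
    obtain Q where Q: "Q \<in> \<Lambda>" "Polynomial.degree Q \<le> Polynomial.degree f"
      "v (to_fract f) = truncation v Q f"
      using v_complete f by blast
    then have "u (to_fract f) = truncation u Q f"
      using poly_transfer[OF f(1)] truncation_transfer[OF f(1) mem[OF Q(1)]] by simp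
    then show ?thesis
      using Q by blast
  qed
  show ?thesis
    unfolding complete_key_sequence_def using key distinct wo complete by blast
qed

end

subsection \<open>Approximating sequences\<close>

context
  fixes \<gamma> :: "'i::{wellorder,no_top} \<Rightarrow> 'g extended" and a :: "'i \<Rightarrow> 'a"
  assumes approx: "cofinal_approximation Kbar v \<gamma> a"
begin

lemma a_mem: "a \<nu> \<in> Kbar"
  and X_val_a: "X_val (a \<nu>) = \<gamma> \<nu>"
  and gamma_less_iff: "\<gamma> \<nu> < \<gamma> \<mu> \<longleftrightarrow> \<nu> < \<mu>"
  and gamma_cofinal: "c \<in> Kbar \<Longrightarrow> \<exists>\<nu>. X_val c \<le> \<gamma> \<nu>"
  using approx by (simp_all add: cofinal_approximation_def strict_mono_less)

lemma w_a_diff: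
  assumes "\<nu> < \<mu>"
  shows "w (a \<nu> - a \<mu>) = \<gamma> \<nu>" "w (a \<mu> - a \<nu>) = \<gamma> \<nu>"
  using w_diff_eq_X_val[OF a_mem a_mem, of \<nu> \<mu>] assms by (simp_all add: X_val_a gamma_less_iff)

lemma pseudo_cauchy_a: "pseudo_cauchy w a"
  by (auto simp: pseudo_cauchy_def w_a_diff gamma_less_iff)

lemma pcs_limit_iff: "pcs_limit w a y \<longleftrightarrow> (\<forall>\<nu>. w (y - a \<nu>) = \<gamma> \<nu>)"
  by (simp add: pcs_limit_def w_a_diff less_succ_index)

lemma gamma_cofinal_strict:
  assumes "c \<in> Kbar"
  shows "\<exists>\<nu>. X_val c < \<gamma> \<nu>"
proof -
  obtain \<nu> where "X_val c \<le> \<gamma> \<nu>"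
    using gamma_cofinal[OF assms] by blast
  also have "\<gamma> \<nu> < \<gamma> (succ_index \<nu>)"
    by (simp add: gamma_less_iff less_succ_index)
  finally show ?thesis ..
qed

text \<open>By cofinality the sequence eventually comes closer to \<open>X\<close> than
  \<open>c\<close> is; from then on \<open>c\<close> is equally far from \<open>a \<nu>\<close> and
  from \<open>X\<close>.\<close>

lemma eventually_const_Kbar:
  assumes "c \<in> Kbar"
  shows "\<exists>\<mu>. X_val c < \<gamma> \<mu> \<and> (\<forall>\<nu>\<ge>\<mu>. w (c - a \<nu>) = X_val c)"
proof -
  obtain \<mu> where \<mu>: "X_val c < \<gamma> \<mu>"
    using gamma_cofinal_strict[OF assms] by blast
  have "w (c - a \<nu>) = X_val c" if "\<mu> \<le> \<nu>" for \<nu>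
  proof -
    have "\<gamma> \<mu> \<le> \<gamma> \<nu>"
      using that gamma_less_iff[of \<nu> \<mu>] by (simp add: not_less[symmetric])
    then have "X_val c < X_val (a \<nu>)"
      using \<mu> unfolding X_val_a by simp
    then show ?thesis
      using w_diff_eq_X_val[OF assms a_mem] by blast
  qed
  with \<mu> show ?thesis by blast
qed

text \<open>Take an index \<open>\<mu>\<close> where \<open>w (c - a \<mu>)\<close> differs from
  \<open>\<gamma> \<mu>\<close>. If it is smaller, the later moves of the sequence are too small to
  change it; if it is larger, every later member is at distance \<open>\<gamma> \<mu>\<close> from
  \<open>c\<close>. Either way the constant lies below some \<open>\<gamma>\<close>, so the distance
  from \<open>c\<close> to \<open>X\<close> will be determined too.\<close>

lemma limit_or_eventually_const:
  obtains (limit) "\<And>\<nu>. w (c - a \<nu>) = \<gamma> \<nu>"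
  | (const) \<mu> \<beta> where "\<beta> < \<gamma> \<mu>" "\<And>\<nu>. \<nu> \<ge> \<mu> \<Longrightarrow> w (c - a \<nu>) = \<beta>"
proof (cases "\<forall>\<nu>. w (c - a \<nu>) = \<gamma> \<nu>")
  case False
  then obtain \<mu> where \<mu>: "w (c - a \<mu>) \<noteq> \<gamma> \<mu>"
    by blast
  have eq: "c - a \<nu> = (c - a \<mu>) + (a \<mu> - a \<nu>)" for \<nu>
    by simp
  show ?thesis
  proof (cases "w (c - a \<mu>) < \<gamma> \<mu>")
    case True
    have "w (c - a \<nu>) = w (c - a \<mu>)" if "\<nu> \<ge> \<mu>" for \<nu>
    proof (cases "\<nu> = \<mu>")
      case False
      then have "w (c - a \<mu>) < w (a \<mu> - a \<nu>)"
        using True that by (simp add: w_a_diff)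
      then show ?thesis
        unfolding eq[of \<nu>] by (intro v_add_eq) simp_all
    qed simp
    with True show ?thesis
      using const by blast
  next
    case False
    then have *: "\<gamma> \<mu> < w (c - a \<mu>)"
      using \<mu> by simp
    have "w (c - a \<nu>) = \<gamma> \<mu>" if "\<nu> \<ge> succ_index \<mu>" for \<nu>
    proof -
      have "\<mu> < \<nu>"
        using less_succ_index that by (rule less_le_trans)
      then have "w (a \<mu> - a \<nu>) = \<gamma> \<mu>"
        by (rule w_a_diff)
      then show ?thesis
        unfolding eq[of \<nu>] using v_add_eq[of "a \<mu> - a \<nu>" "c - a \<mu>"] * by (simp add: add.commute)
    qed
    moreover have "\<gamma> \<mu> < \<gamma> (succ_index \<mu>)"
      by (simp add: gamma_less_iff less_succ_index)
    ultimately show ?thesis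
      using const by blast
  qed
qed (use limit in blast)

end

end

section \<open>The transcendental case\<close>

locale transcendental_approximation = rational_extension w K L v
  for w :: "'a::alg_closed_field \<Rightarrow> 'g::linordered_ab_group_add extended" and K L v +
  fixes \<gamma> :: "'i::{wellorder,no_top} \<Rightarrow> 'g extended" and a :: "'i \<Rightarrow> 'a"
  assumes approx: "cofinal_approximation Kbar v \<gamma> a"
    and no_limit: "\<And>c. \<exists>\<nu>. w (c - a \<nu>) \<noteq> \<gamma> \<nu>"
begin

definition ultimate :: "'a poly \<Rightarrow> 'g extended \<Rightarrow> bool" where
  "ultimate p \<beta> \<longleftrightarrow> (\<exists>\<mu>. \<forall>\<nu>\<ge>\<mu>. w (poly p (a \<nu>)) = \<beta>)"

text \<open>This is Kaplansky's prescription for the extension in which \<open>X\<close> becomes a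
  limit of a sequence of transcendental type.\<close>

definition ultimate_value :: "'a poly \<Rightarrow> 'g extended" where
  "ultimate_value p = (THE \<beta>. ultimate p \<beta>)"

lemma ultimate_mult:
  assumes "ultimate p \<beta>" "ultimate q \<beta>'"
  shows "ultimate (p * q) (\<beta> + \<beta>')"
proof -
  obtain \<mu> \<mu>' where "\<forall>\<nu>\<ge>\<mu>. w (poly p (a \<nu>)) = \<beta>" "\<forall>\<nu>\<ge>\<mu>'. w (poly q (a \<nu>)) = \<beta>'"
    using assms by (auto simp: ultimate_def)
  then show ?thesis
    unfolding ultimate_def by (intro exI[of _ "max \<mu> \<mu>'"]) (simp add: v_mult)
qed

lemma ultimate_unique:
  assumes "ultimate p \<beta>" "ultimate p \<beta>'"
  shows "\<beta> = \<beta>'"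
proof -
  obtain \<mu> \<mu>' where "\<forall>\<nu>\<ge>\<mu>. w (poly p (a \<nu>)) = \<beta>" "\<forall>\<nu>\<ge>\<mu>'. w (poly p (a \<nu>)) = \<beta>'"
    using assms by (auto simp: ultimate_def)
  then have "w (poly p (a (max \<mu> \<mu>'))) = \<beta>" "w (poly p (a (max \<mu> \<mu>'))) = \<beta>'"
    using max.cobounded1 max.cobounded2 by blast+
  then show ?thesis by simp
qed

lemma ultimate_value_eqI: "ultimate p \<beta> \<Longrightarrow> ultimate_value p = \<beta>"
  unfolding ultimate_value_def by (rule the_equality) (auto intro: ultimate_unique)

lemma ultimate_const: "ultimate [:c:] (w c)"
  by (simp add: ultimate_def)

lemma linear_ultimate:
  obtains \<mu> \<beta> where "\<beta> < \<gamma> \<mu>" "\<And>\<nu>. \<nu> \<ge> \<mu> \<Longrightarrow> w (c - a \<nu>) = \<beta>" "ultimate [:-c, 1:] \<beta>"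
proof -
  obtain \<mu> \<beta> where *: "\<beta> < \<gamma> \<mu>" "\<And>\<nu>. \<nu> \<ge> \<mu> \<Longrightarrow> w (c - a \<nu>) = \<beta>"
    by (rule limit_or_eventually_const[OF approx, of c]) (use no_limit[of c] in auto)
  then have "\<forall>\<nu>\<ge>\<mu>. w (a \<nu> - c) = \<beta>"
    using v_diff_commute[of c] by simp
  then have "ultimate [:-c, 1:] \<beta>"
    unfolding ultimate_def by (intro exI[of _ \<mu>]) simp
  with * show ?thesis
    by (rule that)
qed

text \<open>No \<open>c\<close> is a limit, so each linear factor becomes constant along the
  sequence, at a value below some \<open>\<gamma>\<close> and hence finite.\<close>

lemma ultimate_ex:
  assumes "p \<noteq> 0"
  shows "\<exists>\<beta>. ultimate p \<beta> \<and> \<beta> \<noteq> \<infinity>"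
  using assms
proof (induction p rule: poly_root_induct)
  case (const c)
  then show ?case
    using ultimate_const[of c] by auto
next
  case (linear x q)
  then obtain \<beta> where "ultimate q \<beta>" "\<beta> \<noteq> \<infinity>"
    by blast
  moreover obtain \<mu> \<beta>' where "\<beta>' < \<gamma> \<mu>" "ultimate [:-x, 1:] \<beta>'"
    by (rule linear_ultimate[of x])
  moreover from this have "\<beta>' \<noteq> \<infinity>"
    by auto
  ultimately show ?case
    using ultimate_mult by (metis ext_add_eq_Pinf_iff)
qed

lemma ultimate_ultimate_value: "ultimate p (ultimate_value p)"
proof (cases "p = 0")
  case True
  have "ultimate 0 \<infinity>"
    by (simp add: ultimate_def)
  then show ?thesis
    using ultimate_value_eqI True by simp
next
  case False
  then show ?thesis
    using ultimate_ex ultimate_value_eqI by metis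
qed

lemma pcs_transcendental_a: "pcs_transcendental UNIV w a"
  using ultimate_ultimate_value pseudo_cauchy_a[OF approx]
  by (simp add: pcs_transcendental_def ultimate_def) blast

lemma ultimate_value_attained:
  obtains \<nu> where "ultimate_value p = w (poly p (a \<nu>))"
  using ultimate_ultimate_value[of p] unfolding ultimate_def by (metis order_refl)

lemma poly_valuation_ultimate_value: "poly_valuation ultimate_value"
  unfolding poly_valuation_def
proof (intro conjI allI)
  fix p q
  show "ultimate_value p \<noteq> -\<infinity>"
    by (rule ultimate_value_attained[of p]) simp
  show "(ultimate_value p = \<infinity>) = (p = 0)"
    using ultimate_ex[of p] ultimate_value_eqI[of p] ultimate_const[of 0] ultimate_value_eqI[of 0 \<infinity>] by auto
  show "ultimate_value (p * q) = ultimate_value p + ultimate_value q"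
    by (intro ultimate_value_eqI ultimate_mult ultimate_ultimate_value)
  obtain \<mu>1 \<mu>2 \<mu>3 where "\<forall>\<nu>\<ge>\<mu>1. w (poly p (a \<nu>)) = ultimate_value p"
    "\<forall>\<nu>\<ge>\<mu>2. w (poly q (a \<nu>)) = ultimate_value q"
    "\<forall>\<nu>\<ge>\<mu>3. w (poly (p + q) (a \<nu>)) = ultimate_value (p + q)"
    using ultimate_ultimate_value unfolding ultimate_def by meson
  moreover define \<mu> where "\<mu> = max \<mu>1 (max \<mu>2 \<mu>3)"
  then have "\<mu>1 \<le> \<mu>" "\<mu>2 \<le> \<mu>" "\<mu>3 \<le> \<mu>"
    by (simp_all add: le_max_iff_disj)
  ultimately have "w (poly p (a \<mu>)) = ultimate_value p" "w (poly q (a \<mu>)) = ultimate_value q"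
    "w (poly (p + q) (a \<mu>)) = ultimate_value (p + q)"
    by blast+
  then show "min (ultimate_value p) (ultimate_value q) \<le> ultimate_value (p + q)"
    using v_add[of "poly p (a \<mu>)" "poly q (a \<mu>)"] by simp
qed

text \<open>For existence, \<open>a \<mu> - a \<nu>\<close> has value \<open>\<gamma> \<nu>\<close>
  for all later \<open>\<mu>\<close>, so \<open>X\<close> is a limit. For uniqueness, a competitor
  gives \<open>X - a \<mu>\<close> the value \<open>\<gamma> \<mu>\<close>; at an index with
  \<open>w (c - a \<mu>) < \<gamma> \<mu>\<close> this forces its value on \<open>X - c\<close>, and
  factorisation does the rest.\<close>

lemma limit_extension_eq: "limit_extension w a = frac_val ultimate_value"
  unfolding limit_extension_def valuation_UNIV_iff
proof (rule the_equality)
  let ?u = "frac_val ultimate_value"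
  have to_fract: "?u (to_fract p) = ultimate_value p" for p
    using poly_valuation_ultimate_value by (rule frac_val_to_fract)
  have "?u (X_fract - const_fract (a \<nu>)) = ?u (const_fract (a \<nu>) - const_fract (a (succ_index \<nu>)))" for \<nu>
  proof -
    have "w (a \<mu> - a \<nu>) = \<gamma> \<nu>" if "succ_index \<nu> \<le> \<mu>" for \<mu>
      using w_a_diff[OF approx] less_succ_index[of \<nu>] that less_le_trans by blast
    then have "ultimate [:- a \<nu>, 1:] (\<gamma> \<nu>)"
      by (auto simp: ultimate_def)
    moreover have "ultimate [:a \<nu> - a (succ_index \<nu>):] (\<gamma> \<nu>)"
      using ultimate_const[of "a \<nu> - a (succ_index \<nu>)"] w_a_diff[OF approx less_succ_index, of \<nu>] by simp
    ultimately show ?thesis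
      unfolding to_fract_diff[symmetric] by (simp add: to_fract ultimate_value_eqI)
  qed
  moreover have "?u (const_fract c) = w c" for c
    by (simp add: to_fract ultimate_value_eqI[OF ultimate_const])
  ultimately show "valuation UNIV ?u \<and> (\<forall>c. ?u (const_fract c) = w c) \<and>
      pcs_limit ?u (\<lambda>\<nu>. const_fract (a \<nu>)) X_fract"
    using valuation_frac_val[OF poly_valuation_ultimate_value] by (simp add: pcs_limit_def)
  fix u assume u: "valuation UNIV u \<and> (\<forall>c. u (const_fract c) = w c) \<and>
    pcs_limit u (\<lambda>\<nu>. const_fract (a \<nu>)) X_fract"
  interpret U: fract_valuation u
    using u by (simp add: fract_valuation_def)
  have u_const: "u (const_fract c) = w c" for c
    using u by blast
  have u_a: "u (X_fract - const_fract (a \<nu>)) = \<gamma> \<nu>" for \<nu>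
  proof -
    have "u (X_fract - const_fract (a \<nu>)) = u (const_fract (a \<nu>) - const_fract (a (succ_index \<nu>)))"
      using u by (auto simp: pcs_limit_def)
    also have "\<dots> = w (a \<nu> - a (succ_index \<nu>))"
      unfolding to_fract_diff[symmetric] by (simp add: u_const)
    finally show ?thesis
      by (simp add: w_a_diff[OF approx] less_succ_index)
  qed
  have u_linear: "u (X_fract - const_fract c) = ultimate_value [:-c, 1:]" for c
  proof -
    obtain \<mu> \<beta> where *: "\<beta> < \<gamma> \<mu>" "\<And>\<nu>. \<nu> \<ge> \<mu> \<Longrightarrow> w (c - a \<nu>) = \<beta>" "ultimate [:-c, 1:] \<beta>"
      by (rule linear_ultimate[of c]) blast
    have "u (const_fract (c - a \<mu>)) < u (X_fract - const_fract (a \<mu>))"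
      using * by (simp add: u_a u_const)
    then have "u ((X_fract - const_fract (a \<mu>)) - const_fract (c - a \<mu>)) = u (const_fract (c - a \<mu>))"
      by (intro U.v_diff_eq) simp_all
    moreover have "(X_fract - const_fract (a \<mu>)) - const_fract (c - a \<mu>) = X_fract - const_fract c"
      unfolding to_fract_diff[symmetric] by simp
    ultimately show ?thesis
      using *(2)[of \<mu>] ultimate_value_eqI[OF *(3)] by (simp add: u_const)
  qed
  have "u (to_fract p) = ultimate_value p" for p
  proof (cases "p = 0")
    case True
    then show ?thesis
      using poly_valuation_ultimate_value ultimate_value_eqI[OF ultimate_const[of 0]] by simp
  next
    case False
    then show ?thesis
    proof (induction p rule: poly_root_induct)
      case (const c)
      then show ?case
        by (simp add: u_const ultimate_value_eqI[OF ultimate_const])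
    next
      case (linear x q)
      moreover have "ultimate_value ([:-x, 1:] * q) = ultimate_value [:-x, 1:] + ultimate_value q"
        using poly_valuation_ultimate_value unfolding poly_valuation_def by blast
      ultimately show ?case
        by (simp only: U.X_val_linear_mult u_linear)
    qed
  qed
  then show "u = ?u"
    using u valuation_frac_val[OF poly_valuation_ultimate_value]
    by (intro fract_valuation_eqI) (auto simp: to_fract)
qed

lemma valuation_limit_extension: "valuation UNIV (limit_extension w a)"
  unfolding limit_extension_eq using poly_valuation_ultimate_value by (rule valuation_frac_val)

lemma limit_extension_to_fract: "limit_extension w a (to_fract p) = ultimate_value p"
  unfolding limit_extension_eq using poly_valuation_ultimate_value by (rule frac_val_to_fract)

lemma limit_extension_const: "limit_extension w a (const_fract c) = w c"
  by (simp add: limit_extension_to_fract ultimate_value_eqI[OF ultimate_const])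

sublocale U: fract_valuation "limit_extension w a"
  using valuation_limit_extension by (simp add: fract_valuation_def)

lemma limit_extension_X_minus_const:
  assumes "c \<in> Kbar"
  shows "limit_extension w a (X_fract - const_fract c) = X_val c"
proof -
  obtain \<mu> where "\<forall>\<nu>\<ge>\<mu>. w (c - a \<nu>) = X_val c"
    using eventually_const_Kbar[OF approx assms] by blast
  then have "ultimate [:-c, 1:] (X_val c)"
    using v_diff_commute[of c] by (auto simp: ultimate_def)
  then show ?thesis
    unfolding U.X_minus_const limit_extension_to_fract by (rule ultimate_value_eqI)
qed

text \<open>An ultimate value is attained at a member of the sequence, hence by a constant. Both the
  bound on \<open>\<delta>\<close> and the immediacy of the extension rest on this.\<close>

lemma limit_extension_value:
  assumes "p \<noteq> 0"
  obtains y where "y \<noteq> 0" "limit_extension w a (to_fract p) = w y"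
proof -
  obtain \<nu> where \<nu>: "ultimate_value p = w (poly p (a \<nu>))"
    by (rule ultimate_value_attained)
  moreover have "ultimate_value p \<noteq> \<infinity>"
    using assms poly_valuation_ultimate_value by (simp add: poly_valuation_def)
  ultimately show ?thesis
    using that[of "poly p (a \<nu>)"] by (auto simp: limit_extension_to_fract)
qed

lemma dense_fract_valuation_limit_extension: "dense_fract_valuation (limit_extension w a) K L"
  by (rule dense_fract_valuation_transfer[of id])
    (simp_all add: valuation_limit_extension limit_extension_const limit_extension_X_minus_const
      strict_mono_def)

sublocale D: dense_fract_valuation "limit_extension w a" K L
  by (rule dense_fract_valuation_limit_extension)

lemma limit_extension_poly:
  "f \<in> polys_over K \<Longrightarrow> limit_extension w a (to_fract f) = v (to_fract f)"
  using poly_transfer[of id "limit_extension w a" f]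
  by (simp add: valuation_limit_extension limit_extension_const limit_extension_X_minus_const
      strict_mono_def)

lemma complete_key_sequence_limit_extension:
  assumes "complete_key_sequence K v \<Lambda>"
  shows "complete_key_sequence L (limit_extension w a) \<Lambda>"
proof -
  let ?u = "limit_extension w a"
  have \<Lambda>: "complete_key_sequence K ?u \<Lambda>"
    by (rule complete_key_sequence_transfer[of id])
      (use assms in \<open>simp_all add: valuation_limit_extension limit_extension_const
        limit_extension_X_minus_const strict_mono_def\<close>)
  \<comment> \<open>Every \<open>\<delta>\<close> is here a value of a nonzero constant, so
    approximation works in all degrees and the whole of \<open>\<Lambda>\<close> is kept.\<close>
  have bound: "\<exists>y. y \<noteq> 0 \<and> delta ?u f \<le> ?u (const_fract y)" if "Polynomial.degree f > 0" for f
  proof -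
    obtain c where "?u (X_fract - const_fract c) = delta ?u f"
      using U.delta_attained[OF \<open>Polynomial.degree f > 0\<close>] by blast
    moreover obtain y where "y \<noteq> 0" "?u (to_fract [:-c, 1:]) = w y"
      by (rule limit_extension_value[of "[:-c, 1:]"]) simp_all
    ultimately show ?thesis
      by (auto simp: U.X_minus_const limit_extension_const)
  qed
  have key: "key_poly L ?u Q" if "Q \<in> \<Lambda>" for Q
    using \<Lambda> that bound by (intro D.key_poly_dense) (auto simp: complete_key_sequence_def)
  have complete: "\<exists>Q\<in>\<Lambda>. Polynomial.degree Q \<le> Polynomial.degree f \<and> ?u (to_fract f) = truncation ?u Q f"
    if f: "f \<in> polys_over L" "Polynomial.degree f > 0" for f
  proof -
    obtain y where "y \<noteq> 0" "delta ?u f \<le> ?u (const_fract y)"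
      using bound[OF f(2)] by blast
    then obtain Q where Q: "Q \<in> \<Lambda>" "Polynomial.degree Q \<le> Polynomial.degree f" "delta ?u f \<le> delta ?u Q"
      by (rule D.complete_key_sequence_dense[OF \<Lambda> f])
    then show ?thesis
      using U.truncation_eq_iff[OF L.subfield_set_axioms key f] by blast
  qed
  have "\<forall>Q\<in>\<Lambda>. \<forall>Q'\<in>\<Lambda>. Q \<noteq> Q' \<longrightarrow> delta ?u Q \<noteq> delta ?u Q'"
    "well_order_on \<Lambda> {(Q, Q'). Q \<in> \<Lambda> \<and> Q' \<in> \<Lambda> \<and> (Q = Q' \<or> delta ?u Q < delta ?u Q')}"
    using \<Lambda> unfolding complete_key_sequence_def by blast+
  with key complete show ?thesis
    unfolding complete_key_sequence_def by blast
qed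

end

section \<open>Immediate extensions by approximation\<close>

lemma valuation_subset:
  assumes "valuation F v" "subfield_set F'" "F' \<subseteq> F"
  shows "valuation F' v"
proof -
  interpret valuation F v by fact
  interpret F': subfield_set F' by fact
  show ?thesis
    by unfold_locales (use assms(3) in \<open>auto intro!: v_mult v_add\<close>)
qed

text \<open>If \<open>u (x - y)\<close> exceeds \<open>u x\<close>, then \<open>y\<close> has the
  same value as \<open>x\<close> and, when this value is nonnegative, the same residue
  class.\<close>

lemma immediate_extensionI:
  assumes "valuation F v" "valuation M u" "F \<subseteq> M" "\<And>x. x \<in> F \<Longrightarrow> u x = v x"
    and approx: "\<And>x. x \<in> M \<Longrightarrow> x \<noteq> 0 \<Longrightarrow> \<exists>y\<in>F. u x < u (x - y)"
  shows "immediate_extension F v M u"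
proof -
  interpret F: valuation F v by fact
  interpret M: valuation M u by fact
  have approx_eq: "\<exists>y\<in>F. u x < u (x - y) \<and> u y = u x" if "x \<in> M" "x \<noteq> 0" for x
  proof -
    obtain y where y: "y \<in> F" "u x < u (x - y)"
      using approx \<open>x \<in> M\<close> \<open>x \<noteq> 0\<close> by blast
    have "y \<in> M"
      using y(1) assms(3) by blast
    then have "u (x - (x - y)) = u x"
      using \<open>x \<in> M\<close> y(2) by (intro M.v_diff_eq) simp_all
    then show ?thesis
      using y by auto
  qed
  have "u ` (M - {0}) \<subseteq> v ` (F - {0})"
  proof
    fix g assume "g \<in> u ` (M - {0})"
    then obtain x where x: "x \<in> M" "x \<noteq> 0" "g = u x"
      by blast
    then obtain y where y: "y \<in> F" "u y = u x"
      using approx_eq by blast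
    then have "y \<noteq> 0"
      using x by (metis M.v_0 M.v_eq_Pinf_iff)
    then show "g \<in> v ` (F - {0})"
      using x y assms(4) by (intro rev_image_eqI[of y]) auto
  qed
  moreover have "u ` (F - {0}) = v ` (F - {0})"
    using assms(4) by (intro image_cong) auto
  then have "v ` (F - {0}) \<subseteq> u ` (M - {0})"
    using image_mono[of "F - {0}" "M - {0}" u] assms(3) by blast
  ultimately have value_group: "value_group (field_on M) u = value_group (field_on F) v"
    by (simp add: value_group_def)
  define I where "I = {x \<in> M. 0 < u x}"
  \<comment> \<open>Additive cosets of the valuation ideal are written as plain sets, so that the
    residue field and \<open>residues\<close> become images of one and the same map.\<close>
  define coset where "coset x = {h + x |h. h \<in> I}" for x
  have coset_eq: "coset x = coset y" if "x \<in> M" "y \<in> M" "0 < u (x - y)" for x y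
  proof -
    have sub: "coset x \<subseteq> coset y" if "x - y \<in> I" for x y
    proof
      fix z assume "z \<in> coset x"
      then obtain h where h: "z = h + x" "h \<in> I"
        by (auto simp: coset_def)
      have "0 < min (u h) (u (x - y))"
        using h(2) that by (simp add: I_def)
      also have "\<dots> \<le> u (h + (x - y))"
        using h(2) that by (intro M.v_add) (simp_all add: I_def)
      finally have "h + (x - y) \<in> I"
        using h(2) that by (simp add: I_def)
      moreover have "z = (h + (x - y)) + y"
        using h(1) by simp
      ultimately show "z \<in> coset y"
        unfolding coset_def by blast
    qed
    have "x - y \<in> I" "y - x \<in> I"
      using that M.v_diff_commute[of x y] by (simp_all add: I_def)
    then show ?thesis
      using sub by blast
  qed
  have "\<exists>y\<in>{x \<in> F. 0 \<le> u x}. coset x = coset y" if x: "x \<in> M" "0 \<le> u x" for x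
  proof (cases "x = 0")
    case True
    then show ?thesis
      by (intro bexI[of _ 0]) simp_all
  next
    case False
    then obtain y where y: "y \<in> F" "u x < u (x - y)" "u y = u x"
      using approx_eq x by blast
    then have "coset x = coset y"
      using x assms(3) by (intro coset_eq) auto
    then show ?thesis
      using x y by auto
  qed
  then have "coset ` {x \<in> M. 0 \<le> u x} = coset ` {x \<in> F. 0 \<le> u x}"
    using assms(3) by (auto simp: image_iff)
  moreover have "carrier (residue_field (field_on M) u) = coset ` {x \<in> M. 0 \<le> u x}"
    unfolding residue_field_def valuation_ring_def valuation_ideal_def FactRing_def
      A_RCOSETS_def' a_r_coset_def' coset_def I_def
    by auto
  moreover have "residues (field_on M) u F = coset ` {x \<in> F. 0 \<le> u x}"
    unfolding residues_def valuation_ring_def valuation_ideal_def a_r_coset_def' coset_def I_def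
    by auto
  ultimately show ?thesis
    using value_group assms(1-4)
    by (simp add: immediate_extension_def valued_extension_def valuation_iff)
qed

context transcendental_approximation
begin

abbreviation u :: "'a poly fract \<Rightarrow> 'g extended" where
  "u \<equiv> limit_extension w a"

text \<open>Both \<open>f\<close> and each power of \<open>X\<close> share their value with a
  constant, so the precision required of a coefficient is the value \<open>w (t / s)\<close> of a
  quotient of constants, which density can beat.\<close>

lemma approximate_poly:
  assumes f: "f \<in> polys_over L" "f \<noteq> 0"
  obtains f' where "f' \<in> polys_over K" "u (to_fract f) < u (to_fract f - to_fract f')"
proof -
  obtain t where t: "t \<noteq> 0" "u (to_fract f) = w t"
    using f(2) by (rule limit_extension_value)
  define M where "M c i = to_fract (Polynomial.monom c i :: 'a poly)" for c i
  have M_eq: "M c i = const_fract c * M 1 i" for c i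
    unfolding M_def to_fract_mult[symmetric] by (simp add: smult_monom)
  have "\<exists>b\<in>K. w t < u (M (Polynomial.coeff f i - b) i)" for i
  proof -
    obtain s where s: "s \<noteq> 0" "u (M 1 i) = w s"
      unfolding M_def by (rule limit_extension_value[of "Polynomial.monom 1 i"]) (simp add: monom_eq_0_iff)
    have "t / s \<noteq> 0"
      using s t by simp
    then obtain b where b: "b \<in> K" "w (t / s) < w (Polynomial.coeff f i - b)"
      using dense_cofinal[of "Polynomial.coeff f i" "t / s"] f(1) by auto
    have "w s + w (t / s) < w s + w (Polynomial.coeff f i - b)"
      using b s by (intro ext_add_less_mono) simp_all
    moreover have "w s + w (t / s) = w t"
      using s by (intro v_divide_add) simp_all
    moreover have "u (M (Polynomial.coeff f i - b) i) = w (Polynomial.coeff f i - b) + w s"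
      unfolding M_eq[of "Polynomial.coeff f i - b"] by (simp only: U.v_mult UNIV_I limit_extension_const s)
    ultimately show ?thesis
      using b(1) by (metis add.commute)
  qed
  then obtain b where b: "\<And>i. b i \<in> K" "\<And>i. w t < u (M (Polynomial.coeff f i - b i) i)"
    by metis
  define f' where "f' = (\<Sum>i\<le>Polynomial.degree f. Polynomial.monom (b i) i)"
  have "f - f' = (\<Sum>i\<le>Polynomial.degree f. Polynomial.monom (Polynomial.coeff f i) i) - f'"
    by (simp add: poly_as_sum_of_monoms)
  also have "\<dots> = (\<Sum>i\<le>Polynomial.degree f. Polynomial.monom (Polynomial.coeff f i - b i) i)"
    by (simp add: f'_def sum_subtractf diff_monom[symmetric])
  finally have eq: "to_fract (f - f') = (\<Sum>i\<le>Polynomial.degree f. M (Polynomial.coeff f i - b i) i)"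
    by (simp add: M_def)
  have "w t < u (to_fract (f - f'))"
    unfolding eq using b(2) t(1) by (intro U.v_sum_gt) simp_all
  moreover have "f' \<in> polys_over K"
    using b(1) by (simp add: f'_def)
  ultimately show ?thesis
    using that t(2) by simp
qed

text \<open>With numerator and denominator replaced by approximants, the error is
  \<open>((p - p') * q - p * (q - q')) / (q * q')\<close>. Both products in the numerator have value
  above \<open>u p + u q\<close>, and \<open>q'\<close> has the value of \<open>q\<close>.\<close>

lemma approximate_ratfunc:
  assumes x: "x \<in> ratfuncs_over L" "x \<noteq> 0"
  shows "\<exists>y\<in>ratfuncs_over K. u x < u (x - y)"
proof -
  obtain f g where fg: "x = to_fract f / to_fract g" "f \<in> polys_over L" "g \<in> polys_over L" "g \<noteq> 0"
    using x(1) by (auto simp: ratfuncs_over_def)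
  then have "f \<noteq> 0"
    using x(2) by auto
  obtain f' where f': "f' \<in> polys_over K" "u (to_fract f) < u (to_fract f - to_fract f')"
    using approximate_poly[OF fg(2) \<open>f \<noteq> 0\<close>] .
  obtain g' where g': "g' \<in> polys_over K" "u (to_fract g) < u (to_fract g - to_fract g')"
    using approximate_poly[OF fg(3,4)] .
  define p q p' q' where "p = to_fract f" "q = to_fract g" "p' = to_fract f'" "q' = to_fract g'"
  note defs = this
  have less: "u p < u (p - p')" "u q < u (q - q')"
    using f' g' by (simp_all only: defs)
  have q0: "q \<noteq> 0" "p \<noteq> 0"
    using fg \<open>f \<noteq> 0\<close> by (simp_all add: defs)
  have q': "u q' = u q"
    using U.v_diff_eq(1)[of q "q - q'"] less by simp
  then have "q' \<noteq> 0"
    using q0 U.v_eq_Pinf_iff[of q] U.v_eq_Pinf_iff[of q'] by auto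
  have fin: "u q \<noteq> \<infinity>" "u q \<noteq> -\<infinity>" "u p \<noteq> \<infinity>" "u p \<noteq> -\<infinity>"
    using q0 by simp_all
  have y: "p' / q' \<in> ratfuncs_over K"
    using f' g' \<open>q' \<noteq> 0\<close> by (auto simp: defs ratfuncs_over_def)
  have "x - p' / q' = ((p - p') * q - p * (q - q')) / (q * q')"
    using fg(1) q0 \<open>q' \<noteq> 0\<close> by (simp add: defs(1,2)[symmetric] field_simps)
  then have eq: "u (q * q') + u (x - p' / q') = u ((p - p') * q - p * (q - q'))"
    using q0 \<open>q' \<noteq> 0\<close> by (simp only: U.v_divide_add UNIV_I mult_eq_0_iff simp_thms)
  have "u p + u q < u ((p - p') * q)"
    using ext_add_less_mono[OF less(1) fin(1,2)] by (simp add: U.v_mult add.commute)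
  moreover have "u p + u q < u (p * (q - q'))"
    using ext_add_less_mono[OF less(2) fin(3,4)] by (simp add: U.v_mult)
  ultimately have "u p + u q < min (u ((p - p') * q)) (u (p * (q - q')))"
    by simp
  also have "\<dots> \<le> u ((p - p') * q - p * (q - q'))"
    by (intro U.v_diff) simp_all
  finally have "u p + u q < u (q * q') + u (x - p' / q')"
    by (simp only: eq)
  moreover have "u p = u q + u x"
    using U.v_divide_add[of p q] q0 fg(1) by (simp add: defs)
  ultimately have "(u q + u q) + u x < (u q + u q) + u (x - p' / q')"
    by (simp add: U.v_mult q' ac_simps)
  then have "u x < u (x - p' / q')"
    using fin by (simp add: add.commute[of "u q + u q"] ext_add_less_cancel ext_add_eq_Pinf_iff ext_add_neq_Minf)
  then show ?thesis
    using y by blast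
qed

lemma immediate_extension_limit_extension:
  "immediate_extension (ratfuncs_over K) v (ratfuncs_over L) u"
proof (rule immediate_extensionI)
  have mem: "to_fract f \<in> ratfuncs_over Kbar" if "f \<in> polys_over K" for f
    using that K_subset_Kbar unfolding polys_over_def by (intro to_fract_mem) (auto simp only: polys_over_def)
  \<comment> \<open>Agreement on polynomials passes to quotients by cancelling the value of the
    denominator; membership is recorded because it makes \<open>v\<close> a valuation on
    \<open>ratfuncs_over K\<close>.\<close>
  have *: "x \<in> ratfuncs_over Kbar \<and> u x = v x" if mem_K: "x \<in> ratfuncs_over K" for x
  proof -
    obtain p q where x: "x = to_fract p / to_fract q" "p \<in> polys_over K" "q \<in> polys_over K" "q \<noteq> 0"
      using mem_K by (auto simp: ratfuncs_over_def)
    have "v (to_fract q) + u x = v (to_fract q) + v x"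
      using U.v_divide_add[of "to_fract p" "to_fract q"] V.v_divide_add[of "to_fract p" "to_fract q"]
        x mem by (simp add: limit_extension_poly)
    moreover have "v (to_fract q) \<noteq> \<infinity>" "v (to_fract q) \<noteq> -\<infinity>"
      using mem[OF x(3)] x(4) by simp_all
    ultimately show ?thesis
      using x mem by (simp add: ext_add_cancel)
  qed
  show "valuation (ratfuncs_over K) v"
    using * by (intro valuation_subset[OF v_valuation] K.subfield_set_ratfuncs_over) blast
  show "valuation (ratfuncs_over L) u"
    by (intro valuation_subset[OF valuation_limit_extension] L.subfield_set_ratfuncs_over) simp
  show "ratfuncs_over K \<subseteq> ratfuncs_over L"
    using polys_over_K_subset unfolding ratfuncs_over_def by blast
  show "u x = v x" if "x \<in> ratfuncs_over K" for x
    using * that by blast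
qed (rule approximate_ratfunc)

end

lemma not_ultimately_const:
  fixes f :: "'i::{wellorder,no_top} \<Rightarrow> 'c::order"
  assumes "\<And>\<nu> \<mu>. \<nu> < \<mu> \<Longrightarrow> f \<nu> < f \<mu>"
  shows "\<not> (\<exists>\<nu>0. \<forall>\<nu>\<ge>\<nu>0. f \<nu> = c)"
proof
  assume "\<exists>\<nu>0. \<forall>\<nu>\<ge>\<nu>0. f \<nu> = c"
  then obtain \<nu>0 where "\<forall>\<nu>\<ge>\<nu>0. f \<nu> = c"
    by blast
  then have "f \<nu>0 = f (succ_index \<nu>0)"
    using less_imp_le[OF less_succ_index[of \<nu>0]] by simp
  moreover have "f \<nu>0 < f (succ_index \<nu>0)"
    by (intro assms less_succ_index)
  ultimately show False
    by simp
qed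

section \<open>The algebraic case\<close>

definition lex_embed :: "'g extended \<Rightarrow> (int \<times> 'g) extended" where
  "lex_embed = map_extended (\<lambda>\<alpha>. (0, \<alpha>))"

lemma lex_lift_eq: "lex_lift w x = lex_embed (w x)"
  by (simp add: lex_lift_def lex_embed_def)

lemma lex_embed_simps [simp]:
  "lex_embed (Fin g) = Fin (0, g)" "lex_embed \<infinity> = \<infinity>" "lex_embed (-\<infinity>) = -\<infinity>"
  by (simp_all add: lex_embed_def)

lemma lex_embed_add:
  fixes x y :: "'g::linordered_ab_group_add extended"
  shows "lex_embed (x + y) = lex_embed x + lex_embed y"
  by (cases x; cases y) simp_all

lemma lex_embed_0: "lex_embed (0 :: 'g::linordered_ab_group_add extended) = 0"
  by (simp add: zero_extended_def zero_prod_def)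

lemma strict_mono_lex_embed: "strict_mono (lex_embed :: 'g::linordered_ab_group_add extended \<Rightarrow> _)"
proof (rule strict_monoI)
  fix x y :: "'g extended"
  assume "x < y"
  then show "lex_embed x < lex_embed y"
    by (cases x; cases y) simp_all
qed

lemma lex_embed_less_top: "x \<noteq> \<infinity> \<Longrightarrow> lex_embed x < Fin (1, 0 :: 'g::linordered_ab_group_add)"
  by (cases x) simp_all

locale algebraic_approximation = rational_extension w K L v
  for w :: "'a::alg_closed_field \<Rightarrow> 'g::linordered_ab_group_add extended" and K L v +
  fixes \<gamma> :: "'i::{wellorder,no_top} \<Rightarrow> 'g extended" and a :: "'i \<Rightarrow> 'a" and \<alpha> :: 'a
  assumes approx: "cofinal_approximation Kbar v \<gamma> a"
    and limit: "w (\<alpha> - a \<nu>) = \<gamma> \<nu>"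
begin

text \<open>At an index where \<open>a \<mu>\<close> is closer to \<open>X\<close> than
  \<open>c\<close> is, \<open>\<alpha>\<close> and \<open>X\<close> are equally close to
  \<open>a \<mu>\<close>, so both see \<open>c\<close> at the same distance.\<close>

lemma w_alpha_diff:
  assumes "c \<in> Kbar"
  shows "w (\<alpha> - c) = X_val c"
proof -
  obtain \<mu> where "X_val c < \<gamma> \<mu>" "w (c - a \<mu>) = X_val c"
    using eventually_const_Kbar[OF approx assms] by blast
  then have "w ((\<alpha> - a \<mu>) - (c - a \<mu>)) = X_val c"
    using v_diff_eq(2)[of "c - a \<mu>" "\<alpha> - a \<mu>"] by (simp add: limit)
  then show ?thesis
    by simp
qed

text \<open>On \<open>Kbar\<close> the values \<open>X_val\<close> are finite, while
  \<open>\<alpha>\<close> has distance \<open>\<infinity>\<close> from itself.\<close>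

lemma alpha_notin_Kbar: "\<alpha> \<notin> Kbar"
  using w_alpha_diff[of \<alpha>] X_val_finite[of \<alpha>] by auto

text \<open>As \<open>\<alpha>\<close> is algebraic over \<open>L\<close>, continuity of roots
  yields elements of \<open>Kbar\<close> arbitrarily close to it, and their distances to
  \<open>\<alpha>\<close> are the values \<open>X_val\<close>. This is the source of both the Cauchy
  property and the uniqueness of the limit.\<close>

lemma approximate_alpha:
  assumes "x \<noteq> 0"
  shows "\<exists>c\<in>Kbar. w x < X_val c"
proof -
  obtain f where f: "f \<in> polys_over L" "f \<noteq> 0" "poly f \<alpha> = 0"
    using algebraic unfolding algebraic_closure_of_def by blast
  obtain f' c where f': "f' \<in> polys_over K" "Polynomial.degree f' = Polynomial.degree f"
    "poly f' c = 0" "w x < w (\<alpha> - c)"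
    using approximate_root[OF f assms] by metis
  have "Polynomial.degree f \<noteq> 0"
  proof
    assume "Polynomial.degree f = 0"
    then obtain c where "f = [:c:]"
      by (rule degree_eq_zeroE)
    then show False
      using f(2,3) by simp
  qed
  then have "f' \<noteq> 0"
    using f'(2) by auto
  then have "c \<in> Kbar"
    using f' root_mem_Kbar by blast
  then show ?thesis
    using f'(4) w_alpha_diff by auto
qed

text \<open>A second limit would differ from \<open>\<alpha>\<close> by an element whose value is at
  least every \<open>\<gamma>'\<close>, although \<open>Kbar\<close> offers larger values. The
  approximating pair and its index type are arbitrary, so independence of the choices is
  included.\<close>

lemma limit_iff:
  fixes \<gamma>' :: "'j::{wellorder,no_top} \<Rightarrow> 'g extended"
  assumes "cofinal_approximation Kbar v \<gamma>' a'"
  shows "pcs_limit w a' b \<longleftrightarrow> b = \<alpha>"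
  unfolding pcs_limit_iff[OF assms]
proof
  have \<alpha>: "w (\<alpha> - a' \<nu>) = \<gamma>' \<nu>" for \<nu>
    using w_alpha_diff[OF a_mem[OF assms]] X_val_a[OF assms] by simp
  then show "\<forall>\<nu>. w (b - a' \<nu>) = \<gamma>' \<nu>" if "b = \<alpha>"
    using that by simp
  assume b: "\<forall>\<nu>. w (b - a' \<nu>) = \<gamma>' \<nu>"
  show "b = \<alpha>"
  proof (rule ccontr)
    assume "b \<noteq> \<alpha>"
    then obtain c where c: "c \<in> Kbar" "w (b - \<alpha>) < X_val c"
      using approximate_alpha[of "b - \<alpha>"] by auto
    then obtain \<nu> where "X_val c \<le> \<gamma>' \<nu>"
      using gamma_cofinal[OF assms] by blast
    also have "\<gamma>' \<nu> \<le> w ((b - a' \<nu>) - (\<alpha> - a' \<nu>))"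
      using v_diff[of "b - a' \<nu>" "\<alpha> - a' \<nu>"] b \<alpha> by simp
    finally show False
      using c(2) by simp
  qed
qed

lemma cauchy_sequence_a: "cauchy_sequence Kbar w a"
  unfolding cauchy_sequence_def
proof (intro conjI ballI)
  fix \<beta> assume "\<beta> \<in> value_group (field_on Kbar) w"
  then obtain x where x: "x \<noteq> 0" "\<beta> = w x"
    by (auto simp: value_group_def)
  then obtain c where c: "c \<in> Kbar" "w x < X_val c"
    using approximate_alpha by blast
  then obtain \<nu> where "X_val c \<le> \<gamma> \<nu>"
    using gamma_cofinal[OF approx] by blast
  then have "\<beta> \<le> \<gamma> \<nu>"
    using c(2) x(2) by (simp add: order.trans[OF less_imp_le])
  then show "\<exists>\<nu>. \<beta> \<le> w (a \<nu> - a (succ_index \<nu>))"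
    using w_a_diff(1)[OF approx less_succ_index] by metis
qed (use a_mem[OF approx] pseudo_cauchy_a[OF approx] in auto)

text \<open>The witness is \<open>X - \<alpha>\<close>: its values along the sequence are the
  strictly increasing \<open>\<gamma> \<nu>\<close>.\<close>

lemma pcs_algebraic_a: "pcs_algebraic UNIV w a"
proof -
  have "\<not> pcs_transcendental UNIV w a"
  proof
    assume "pcs_transcendental UNIV w a"
    moreover have "[:-\<alpha>, 1:] \<in> polys_over UNIV"
      by simp
    ultimately have "\<exists>c \<nu>0. \<forall>\<nu>\<ge>\<nu>0. w (poly [:-\<alpha>, 1:] (a \<nu>)) = c"
      unfolding pcs_transcendental_def by blast
    moreover have "w (poly [:-\<alpha>, 1:] (a \<nu>)) = \<gamma> \<nu>" for \<nu>
      using limit[of \<nu>] v_diff_commute[of \<alpha> "a \<nu>"] by simp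
    ultimately obtain c where "\<exists>\<nu>0. \<forall>\<nu>\<ge>\<nu>0. \<gamma> \<nu> = c"
      by auto
    then show False
      using not_ultimately_const[of \<gamma> c] gamma_less_iff[OF approx] by blast
  qed
  then show ?thesis
    using pseudo_cauchy_a[OF approx] by (simp add: pcs_algebraic_def)
qed

abbreviation u :: "'a poly fract \<Rightarrow> (int \<times> 'g) extended" where
  "u \<equiv> monomial_valuation (lex_lift w) \<alpha> (1, 0)"

lemma total_valuation_lex_lift: "total_valuation (lex_lift w)"
proof
  fix x y
  show "lex_lift w x \<noteq> -\<infinity>"
    using v_neq_Minf[of x] by (cases "w x") (auto simp: lex_lift_eq)
  show "(lex_lift w x = \<infinity>) = (x = 0)"
    using v_eq_Pinf_iff[of x] by (cases "w x") (auto simp: lex_lift_eq)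
  show "lex_lift w (x * y) = lex_lift w x + lex_lift w y"
    by (simp add: lex_lift_eq v_mult lex_embed_add)
  have "mono (lex_embed :: 'g extended \<Rightarrow> _)"
    by (rule strict_mono_mono[OF strict_mono_lex_embed])
  then show "min (lex_lift w x) (lex_lift w y) \<le> lex_lift w (x + y)"
    using v_add[of x y] by (simp add: lex_lift_eq min_of_mono monoD)
qed

sublocale Lex: total_valuation "lex_lift w"
  by (rule total_valuation_lex_lift)

sublocale U: fract_valuation u
  using Lex.monomial_valuation(1) by (simp add: fract_valuation_def)

lemma u_const: "u (const_fract c) = lex_embed (w c)"
  by (simp add: Lex.monomial_valuation(2) Lex.gauss_const lex_lift_eq)

lemma u_X_minus_const: "u (X_fract - const_fract c) = (if c = \<alpha> then Fin (1, 0) else lex_embed (w (\<alpha> - c)))"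
proof -
  have "pcompose [:-c, 1:] [:\<alpha>, 1:] = [:\<alpha> - c, 1:]"
    by (simp add: pcompose_pCons)
  then have "u (X_fract - const_fract c) = min (lex_embed (w (\<alpha> - c))) (Fin (1, 0))"
    unfolding U.X_minus_const Lex.monomial_valuation(2) by (simp add: Lex.gauss_linear lex_lift_eq)
  moreover have "lex_embed (w (\<alpha> - c)) < Fin (1, 0)" if "c \<noteq> \<alpha>"
    using that by (intro lex_embed_less_top) simp
  ultimately show ?thesis
    by (auto simp: min.absorb1 less_imp_le)
qed

lemma u_X_minus_const_Kbar:
  assumes "c \<in> Kbar"
  shows "u (X_fract - const_fract c) = lex_embed (X_val c)"
  using assms w_alpha_diff alpha_notin_Kbar by (auto simp: u_X_minus_const)

lemma delta_alpha_root:
  assumes "Polynomial.degree f > 0" "poly f \<alpha> = 0"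
  shows "delta u f = Fin (1, 0)"
proof (rule antisym)
  have "lex_embed (w (\<alpha> - c)) \<le> Fin (1, 0)" if "c \<noteq> \<alpha>" for c
    using that by (intro less_imp_le lex_embed_less_top) simp
  then show "delta u f \<le> Fin (1, 0)"
    using U.delta_le_iff[OF assms(1)] by (simp add: u_X_minus_const)
  have "f \<noteq> 0"
    using assms(1) by auto
  then show "Fin (1, 0) \<le> delta u f"
    using U.X_val_le_delta[OF _ assms(2)] by (simp add: u_X_minus_const)
qed

text \<open>The root closest to \<open>X\<close> is some \<open>c\<close> other than
  \<open>\<alpha>\<close>, and \<open>\<alpha> - c\<close> itself is the constant that bounds
  \<open>\<delta>\<close>.\<close>

lemma delta_not_alpha_root:
  assumes "Polynomial.degree f > 0" "poly f \<alpha> \<noteq> 0"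
  shows "delta u f < Fin (1, 0)" "\<exists>y. y \<noteq> 0 \<and> delta u f \<le> u (const_fract y)"
proof -
  obtain c where c: "poly f c = 0" "u (X_fract - const_fract c) = delta u f"
    using assms(1) by (rule U.delta_attained)
  then have "c \<noteq> \<alpha>"
    using assms(2) by auto
  then have eq: "delta u f = lex_embed (w (\<alpha> - c))"
    using c(2) by (simp add: u_X_minus_const)
  show "delta u f < Fin (1, 0)"
    unfolding eq using \<open>c \<noteq> \<alpha>\<close> by (intro lex_embed_less_top) simp
  show "\<exists>y. y \<noteq> 0 \<and> delta u f \<le> u (const_fract y)"
    using \<open>c \<noteq> \<alpha>\<close> by (intro exI[of _ "\<alpha> - c"]) (simp add: eq u_const)
qed

abbreviation M :: "'a poly" where
  "M \<equiv> minimal_poly L \<alpha>"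

text \<open>The definite description is justified because two monic candidates have equal degree and
  their difference, if nonzero, would be a polynomial of smaller degree vanishing at
  \<open>\<alpha>\<close>.\<close>

lemma minimal_poly:
  "M \<in> polys_over L" "Polynomial.lead_coeff M = 1" "poly M \<alpha> = 0"
  "\<And>f. f \<in> polys_over L \<Longrightarrow> f \<noteq> 0 \<Longrightarrow> poly f \<alpha> = 0 \<Longrightarrow> Polynomial.degree M \<le> Polynomial.degree f"
proof -
  define S where "S = {f \<in> polys_over L. f \<noteq> 0 \<and> poly f \<alpha> = 0}"
  obtain f0 where "f0 \<in> S"
    using algebraic unfolding algebraic_closure_of_def S_def by blast
  define f where "f = (ARG_MIN Polynomial.degree f. f \<in> S)"
  have f: "f \<in> S" "\<And>g. g \<in> S \<Longrightarrow> Polynomial.degree f \<le> Polynomial.degree g"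
    unfolding f_def using \<open>f0 \<in> S\<close> arg_min_natI[of "\<lambda>f. f \<in> S"] arg_min_nat_le[of "\<lambda>f. f \<in> S"] by blast+
  define Q where "Q = Polynomial.smult (inverse (Polynomial.lead_coeff f)) f"
  let ?P = "\<lambda>Q. Q \<in> polys_over L \<and> Polynomial.lead_coeff Q = 1 \<and> poly Q \<alpha> = 0 \<and>
     (\<forall>f\<in>polys_over L. f \<noteq> 0 \<and> poly f \<alpha> = 0 \<longrightarrow> Polynomial.degree Q \<le> Polynomial.degree f)"
  have Q: "?P Q"
    using f by (auto simp: Q_def S_def)
  have unique: "Q' = Q" if Q': "?P Q'" for Q'
  proof (rule ccontr)
    assume neq: "Q' \<noteq> Q"
    have nz: "Q \<noteq> 0" "Q' \<noteq> 0"
      using Q Q' by auto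
    then have deg: "Polynomial.degree Q' = Polynomial.degree Q"
      using Q Q' by (meson le_antisym)
    have mem: "Q' - Q \<in> polys_over L" "Q' - Q \<noteq> 0" "poly (Q' - Q) \<alpha> = 0"
      using Q Q' neq by auto
    then have "Polynomial.degree Q \<le> Polynomial.degree (Q' - Q)"
      using Q by blast
    moreover have "Polynomial.degree (Q' - Q) \<le> Polynomial.degree Q"
      using degree_diff_le[of Q' "Polynomial.degree Q" Q] deg by simp
    ultimately have "Polynomial.degree (Q' - Q) = Polynomial.degree Q"
      by simp
    moreover have "Polynomial.coeff Q' (Polynomial.degree Q) = 1"
      using Q' unfolding deg[symmetric] by blast
    ultimately have "Polynomial.lead_coeff (Q' - Q) = 0"
      using Q by simp
    then show False
      using mem(2) by (simp only: leading_coeff_0_iff)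
  qed
  have "?P M"
    unfolding minimal_poly_def using Q unique by (rule theI)
  then show "M \<in> polys_over L" "Polynomial.lead_coeff M = 1" "poly M \<alpha> = 0"
    "\<And>f. f \<in> polys_over L \<Longrightarrow> f \<noteq> 0 \<Longrightarrow> poly f \<alpha> = 0 \<Longrightarrow> Polynomial.degree M \<le> Polynomial.degree f"
    by blast+
qed

lemma degree_minimal_poly: "Polynomial.degree M > 0"
proof (rule ccontr)
  assume "\<not> ?thesis"
  then obtain c where "M = [:c:]"
    by (auto elim: degree_eq_zeroE)
  then show False
    using minimal_poly(2,3) by simp
qed

lemma poly_alpha_neq_0:
  assumes "f \<in> polys_over L" "Polynomial.degree f > 0" "Polynomial.degree f < Polynomial.degree M"
  shows "poly f \<alpha> \<noteq> 0"
  using minimal_poly(4)[OF assms(1)] assms(2,3) by (metis degree_0 less_irrefl not_le)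

lemma dense_fract_valuation_u: "dense_fract_valuation u K L"
  by (rule dense_fract_valuation_transfer[of lex_embed])
    (simp_all add: strict_mono_lex_embed lex_embed_add lex_embed_0 Lex.monomial_valuation(1) u_const
      u_X_minus_const_Kbar)

sublocale D: dense_fract_valuation u K L
  by (rule dense_fract_valuation_u)

text \<open>Members of \<open>\<Lambda>\<close> have their roots in \<open>Kbar\<close>, which omits
  \<open>\<alpha>\<close>; hence their \<open>\<delta>\<close> stays below \<open>(1, 0)\<close>,
  the value taken by \<open>M\<close>. So \<open>M\<close> is a new top element.\<close>

lemma complete_key_sequence_minimal_poly:
  assumes "complete_key_sequence K v \<Lambda>"
  shows "complete_key_sequence L u ({Q \<in> \<Lambda>. Polynomial.degree Q \<le> Polynomial.degree M} \<union> {M})"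
proof -
  define \<Lambda>' where "\<Lambda>' = {Q \<in> \<Lambda>. Polynomial.degree Q \<le> Polynomial.degree M}"
  have \<Lambda>: "complete_key_sequence K u \<Lambda>"
    by (rule complete_key_sequence_transfer[of lex_embed])
      (use assms in \<open>simp_all add: strict_mono_lex_embed lex_embed_add lex_embed_0
        Lex.monomial_valuation(1) u_const u_X_minus_const_Kbar\<close>)
  have key_K: "\<And>Q. Q \<in> \<Lambda> \<Longrightarrow> key_poly K u Q"
    and distinct_K: "\<forall>Q\<in>\<Lambda>. \<forall>Q'\<in>\<Lambda>. Q \<noteq> Q' \<longrightarrow> delta u Q \<noteq> delta u Q'"
    and wo_K: "well_order_on \<Lambda> {(Q, Q'). Q \<in> \<Lambda> \<and> Q' \<in> \<Lambda> \<and> (Q = Q' \<or> delta u Q < delta u Q')}"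
    using \<Lambda> unfolding complete_key_sequence_def by blast+
  have delta_M: "delta u M = Fin (1, 0)"
    using degree_minimal_poly minimal_poly(3) by (rule delta_alpha_root)
  have delta_less: "delta u Q < delta u M" if "Q \<in> \<Lambda>" for Q
  proof -
    have Q: "Q \<in> polys_over K" "Polynomial.degree Q > 0"
      using key_K[OF that] by (auto simp: key_poly_def)
    then have "Q \<noteq> 0"
      by auto
    then have "poly Q \<alpha> \<noteq> 0"
      using Q root_mem_Kbar[of Q \<alpha>] alpha_notin_Kbar by auto
    then show ?thesis
      unfolding delta_M using Q by (intro delta_not_alpha_root)
  qed
  have bound: "\<exists>y. y \<noteq> 0 \<and> delta u f \<le> u (const_fract y)" "delta u f < delta u M"
    if "f \<in> polys_over L" "Polynomial.degree f > 0" "Polynomial.degree f < Polynomial.degree M" for f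
    unfolding delta_M using that poly_alpha_neq_0 delta_not_alpha_root by blast+
  have key_M: "key_poly L u M"
    unfolding key_poly_def using minimal_poly degree_minimal_poly bound(2) by blast
  \<comment> \<open>The degree of \<open>Q\<close> may equal that of \<open>M\<close>: the key
    property tests only smaller degrees, where no nonconstant polynomial over \<open>L\<close>
    vanishes at \<open>\<alpha>\<close>.\<close>
  have key: "key_poly L u Q" if "Q \<in> \<Lambda>' \<union> {M}" for Q
  proof (cases "Q = M")
    case False
    then have "Q \<in> \<Lambda>" "Polynomial.degree Q \<le> Polynomial.degree M"
      using that by (auto simp: \<Lambda>'_def)
    then show ?thesis
      using key_K bound(1) by (intro D.key_poly_dense) auto
  qed (use key_M in simp)
  have "delta u Q \<noteq> delta u M" "delta u M \<noteq> delta u Q" if "Q \<in> \<Lambda>" for Q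
    using delta_less[OF that] by simp_all
  then have distinct: "\<forall>Q\<in>\<Lambda>' \<union> {M}. \<forall>Q'\<in>\<Lambda>' \<union> {M}. Q \<noteq> Q' \<longrightarrow> delta u Q \<noteq> delta u Q'"
    using distinct_K by (auto simp: \<Lambda>'_def)
  let ?R = "\<lambda>S. {(Q, Q'). Q \<in> S \<and> Q' \<in> S \<and> delta u Q < delta u Q'}"
  have wf_\<Lambda>: "wf (?R \<Lambda>)"
    using wo_K well_order_on_delta_iff[OF distinct_K] by blast
  have "wf (?R (\<Lambda>' \<union> {M}))"
    unfolding wf_eq_minimal
  proof (intro allI impI)
    fix B and x :: "'a poly"
    assume "x \<in> B"
    \<comment> \<open>Since \<open>M\<close> lies on top, a minimal element is sought within
      \<open>\<Lambda>'\<close>. If \<open>B\<close> misses \<open>\<Lambda>'\<close>, any element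
      of \<open>B\<close> will do, as all predecessors lie in \<open>\<Lambda>'\<close>.\<close>
    show "\<exists>z\<in>B. \<forall>y. (y, z) \<in> ?R (\<Lambda>' \<union> {M}) \<longrightarrow> y \<notin> B"
    proof (cases "B \<inter> \<Lambda>' = {}")
      case True
      then show ?thesis
        using \<open>x \<in> B\<close> by auto
    next
      case False
      then obtain z where z: "z \<in> B \<inter> \<Lambda>'" "\<And>y. (y, z) \<in> ?R \<Lambda> \<Longrightarrow> y \<notin> B \<inter> \<Lambda>'"
        using wf_\<Lambda> unfolding wf_eq_minimal by (metis (no_types, lifting) ex_in_conv)
      have "y \<notin> B" if "(y, z) \<in> ?R (\<Lambda>' \<union> {M})" for y
      proof -
        have "delta u y < delta u z" "z \<in> \<Lambda>"
          using that z(1) by (auto simp: \<Lambda>'_def)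
        then have "y \<noteq> M"
          using delta_less[of z] by auto
        then have "y \<in> \<Lambda>'"
          using that by auto
        then show ?thesis
          using z(2)[of y] that z(1) by (auto simp: \<Lambda>'_def)
      qed
      then show ?thesis
        using z(1) by blast
    qed
  qed
  then have wo: "well_order_on (\<Lambda>' \<union> {M})
    {(Q, Q'). Q \<in> \<Lambda>' \<union> {M} \<and> Q' \<in> \<Lambda>' \<union> {M} \<and> (Q = Q' \<or> delta u Q < delta u Q')}"
    using well_order_on_delta_iff[OF distinct] by blast
  have complete: "\<exists>Q\<in>\<Lambda>' \<union> {M}. Polynomial.degree Q \<le> Polynomial.degree f \<and> u (to_fract f) = truncation u Q f"
    if f: "f \<in> polys_over L" "Polynomial.degree f > 0" for f
  proof -
    \<comment> \<open>Below the degree of \<open>M\<close> the sequence over \<open>K\<close>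
      supplies a member of degree at most that of \<open>f\<close>, hence in
      \<open>\<Lambda>'\<close>. From that degree on \<open>M\<close> itself serves, its
      \<open>\<delta>\<close> being the largest possible.\<close>
    have "\<exists>Q\<in>\<Lambda>' \<union> {M}. Polynomial.degree Q \<le> Polynomial.degree f \<and> delta u f \<le> delta u Q"
    proof (cases "Polynomial.degree f < Polynomial.degree M")
      case True
      then obtain y where "y \<noteq> 0" "delta u f \<le> u (const_fract y)"
        using bound(1) f by blast
      then obtain Q where "Q \<in> \<Lambda>" "Polynomial.degree Q \<le> Polynomial.degree f" "delta u f \<le> delta u Q"
        by (rule D.complete_key_sequence_dense[OF \<Lambda> f])
      then show ?thesis
        using True by (intro bexI[of _ Q]) (auto simp: \<Lambda>'_def)
    next
      case False
      moreover have "delta u f \<le> delta u M"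
        using delta_alpha_root[OF f(2)] delta_not_alpha_root(1)[OF f(2)]
        by (cases "poly f \<alpha> = 0") (simp_all add: delta_M)
      ultimately show ?thesis
        by (intro bexI[of _ M]) simp_all
    qed
    then show ?thesis
      using U.truncation_eq_iff[OF L.subfield_set_axioms key f] by blast
  qed
  show ?thesis
    unfolding complete_key_sequence_def \<Lambda>'_def[symmetric] using key distinct wo complete by blast
qed

end

section \<open>The dichotomy between transcendental and algebraic type\<close>

theorem theorem4p2:
  fixes K Khat :: "'a::alg_closed_field set"
    and v :: "'a poly fract \<Rightarrow> 'g::linordered_ab_group_add extended"
    and w :: "'a \<Rightarrow> 'g extended"
    and \<gamma> :: "'i::{wellorder,no_top} \<Rightarrow> 'g extended"
    and a :: "'i \<Rightarrow> 'a"
    and \<Lambda> :: "'a poly set"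
  assumes "subfield K whole_field"
    and "valued_extension (const_fract ` K) v (ratfuncs_over (algebraic_closure_of K)) v"
    and "valuation_algebraic (const_fract ` K) (ratfuncs_over K) v"
    and "is_completion K Khat w"
    and "algebraic_closure_of Khat = UNIV"
    and "valued_field whole_field w"
    and "\<forall>c\<in>algebraic_closure_of K. w c = v (const_fract c)"
    and "cofinal_approximation (algebraic_closure_of K) v \<gamma> a"
    and "complete_key_sequence K v \<Lambda>"
  shows
    "(pcs_transcendental UNIV w a \<and>
      complete_key_sequence Khat (limit_extension w a) \<Lambda> \<and>
      immediate_extension (ratfuncs_over K) v (ratfuncs_over Khat) (limit_extension w a))
     \<or>
     (pcs_algebraic UNIV w a \<and>
      cauchy_sequence (algebraic_closure_of K) w a \<and>
      (\<exists>\<alpha>. (\<forall>b. pcs_limit w a b \<longleftrightarrow> b = \<alpha>) \<and>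
        complete_key_sequence Khat (monomial_valuation (lex_lift w) \<alpha> (1, 0))
          ({Q \<in> \<Lambda>. Polynomial.degree Q \<le> Polynomial.degree (minimal_poly Khat \<alpha>)}
             \<union> {minimal_poly Khat \<alpha>}) \<and>
        (\<forall>(\<gamma>' :: 'j::{wellorder,no_top} \<Rightarrow> 'g extended) a'.
           cofinal_approximation (algebraic_closure_of K) v \<gamma>' a' \<longrightarrow>
           (\<forall>b. pcs_limit w a' b \<longleftrightarrow> b = \<alpha>))))"
proof -
  have K: "valuation K w" and Khat: "valuation Khat w" and "K \<subseteq> Khat"
    and dense: "dense_in K (field_on Khat) w"
    using assms(4) by (simp_all add: is_completion_def valued_extension_def valuation_iff)
  interpret K: valuation K w by fact
  interpret L: valuation Khat w by fact
  have "\<exists>b\<in>K. w y < w (x - b)" if x: "x \<in> Khat" "y \<in> Khat" "y \<noteq> 0" for x y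
  proof -
    have "w y \<in> value_group (field_on Khat) w"
      using x by (simp add: value_group_def)
    then obtain b where b: "b \<in> K" "w y < w (x \<ominus>\<^bsub>field_on Khat\<^esub> b)"
      using dense x(1) by (auto simp: dense_in_def)
    then have "x \<ominus>\<^bsub>field_on Khat\<^esub> b = x - b"
      using \<open>K \<subseteq> Khat\<close> x(1) by (intro a_minus_field_on L.field_field_on) auto
    then show ?thesis
      using b by auto
  qed
  moreover have "valuation UNIV w"
    using assms(6) by (simp add: valuation_UNIV_iff)
  moreover have "valuation (ratfuncs_over (algebraic_closure_of K)) v"
    using assms(2) by (simp add: valued_extension_def valuation_iff)
  ultimately interpret rational_extension w K Khat v
    using assms(5,7) \<open>K \<subseteq> Khat\<close> K.subfield_set_axioms L.subfield_set_axioms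
    by (simp add: rational_extension_def rational_extension_axioms_def dense_subfields_def
        dense_subfields_axioms_def total_valuation_def)
  show ?thesis
  proof (cases "\<exists>\<alpha>. \<forall>\<nu>. w (\<alpha> - a \<nu>) = \<gamma> \<nu>")
    case True
    then obtain \<alpha> where "\<And>\<nu>. w (\<alpha> - a \<nu>) = \<gamma> \<nu>"
      by blast
    then interpret algebraic_approximation w K Khat v \<gamma> a \<alpha>
      using assms(8) by unfold_locales
    \<comment> \<open>\<open>limit_iff\<close> enters twice: applied to \<open>approx\<close> it
      makes \<open>\<alpha>\<close> the only limit of \<open>a\<close>, and in general form, over
      another index type, it gives independence of the chosen sequences.\<close>
    show ?thesis
      using pcs_algebraic_a cauchy_sequence_a limit_iff[OF approx] limit_iff
        complete_key_sequence_minimal_poly[OF assms(9)] by blast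
  next
    case False
    then interpret transcendental_approximation w K Khat v \<gamma> a
      using assms(8) by unfold_locales auto
    show ?thesis
      using pcs_transcendental_a complete_key_sequence_limit_extension[OF assms(9)]
        immediate_extension_limit_extension by blast
  qed
qed

end
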